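(* For a prime $p$ and a polynomial $P(z)\in\mathbb{Z}[z]$ with $P(0)=1$, let $F(z)=\prod_{n\ge0}P(z^{p^n})\in\mathbb{Z}[[z]]$ (the unique power series with constant term $1$ satisfying $F(z)=P(z)F(z^p)$). Define $F_5,F_{11},F_{13},F_{17a},F_{17b}$ in this way with respectively $p=5$, $P(z)=1-z-z^2-z^3+z^4$; $p=11$, $P(z)=1-z-z^2+z^3-z^4+z^5+z^6+z^7+z^8-z^9-z^{10}$; $p=13$, $P(z)=1-z-z^2+z^3-z^4-z^5-z^6-z^7-z^8+z^9-z^{10}-z^{11}+z^{12}$; $p=17$, $P(z)=1-z-z^2+z^3-z^4+z^5+z^6+z^7+z^8+z^9+z^{10}+z^{11}-z^{12}+z^{13}-z^{14}-z^{15}+z^{16}$; $p=17$, $P(z)=1-z-z^2-z^3+z^4+z^5-z^6+z^7+z^8+z^9-z^{10}+z^{11}+z^{12}-z^{13}-z^{14}-z^{15}+z^{16}$. Then for all integers $b\ge2$, the numbers $F_5(1/b)$, $F_{11}(1/b)$, $F_{13}(1/b)$, $F_{17a}(1/b)$, $F_{17b}(1/b)$ are transcendental and their irrationality exponents are equal to $2$.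
   Context: The irrationality exponent $\mu(\xi)$ of an irrational real number $\xi$ is the supremum of the real numbers $\mu$ such that $|\xi-p/q|<q^{-\mu}$ has infinitely many solutions in rational numbers $p/q$. *)

theory Defs
  imports "HOL-Analysis.Analysis" "HOL-Computational_Algebra.Computational_Algebra"
begin

text \<open>The formal power series F(z) = prod_{n>=0} P(z^(p^n)) in Z[[z]] (P(0) = 1).
  Its n-th coefficient agrees with that of the finite product over k < N
  as soon as p^N > n; taking N = n+1 suffices since p >= 2.\<close>
definition mahler_prod_fps :: "nat \<Rightarrow> int poly \<Rightarrow> int fps" where
  "mahler_prod_fps p P =
     Abs_fps (\<lambda>n. coeff (\<Prod>k<Suc n. pcompose P (monom 1 (p ^ k))) n)"

definition fps_eval_real :: "int fps \<Rightarrow> real \<Rightarrow> real" where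
  "fps_eval_real F x = (\<Sum>n. real_of_int (fps_nth F n) * x ^ n)"

definition irrationality_exponent :: "real \<Rightarrow> ereal" where
  "irrationality_exponent \<xi> =
     Sup (ereal ` {\<mu>::real. infinite {r::rat.
        \<bar>\<xi> - real_of_rat r\<bar> < real_of_int (snd (quotient_of r)) powr (- \<mu>)}})"

definition P5 :: "int poly" where "P5 = Poly [1,-1,-1,-1,1]"
definition P11 :: "int poly" where "P11 = Poly [1,-1,-1,1,-1,1,1,1,1,-1,-1]"
definition P13 :: "int poly" where "P13 = Poly [1,-1,-1,1,-1,-1,-1,-1,-1,1,-1,-1,1]"
definition P17a :: "int poly" where
  "P17a = Poly [1,-1,-1,1,-1,1,1,1,1,1,1,1,-1,1,-1,-1,1]"
definition P17b :: "int poly" where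
  "P17b = Poly [1,-1,-1,-1,1,1,-1,1,1,1,-1,1,1,-1,-1,-1,1]"

definition F5 where "F5 = mahler_prod_fps 5 P5"
definition F11 where "F11 = mahler_prod_fps 11 P11"
definition F13 where "F13 = mahler_prod_fps 13 P13"
definition F17a where "F17a = mahler_prod_fps 17 P17a"
definition F17b where "F17b = mahler_prod_fps 17 P17b"

end

theory Submission
  imports Defs "HOL-Library.Z2" "HOL-Computational_Algebra.Field_as_Ring"
begin

text \<open>
The coefficients \<open>f\<^sub>n\<close> of \<open>F\<close> are signs, and a check on the base-\<open>p\<close> digits gives
\<open>f\<^bsub>2m+1\<^esub> f\<^bsub>2m+2\<^esub> f\<^sub>m f\<^bsub>m+1\<^esub> = -1\<close> for all \<open>m\<close>. If \<open>h\<^sub>j\<close> in \<open>F\<^sub>2\<close> records whether \<open>f\<^sub>j\<close> and \<open>f\<^bsub>j+2\<^esub>\<close> differ, this says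
\<open>h\<^bsub>2i+1\<^esub> + h\<^bsub>2i+2\<^esub> = h\<^sub>i\<close> and \<open>h\<^sub>0 = 1\<close>, which forces all Hankel matrices of \<open>h\<close>, and then those of \<open>f\<close>,
to be nonsingular. So for every \<open>n\<close> there is a Pade form \<open>Q F - R\<close> of order exactly \<open>2n\<close>. Evaluated at
\<open>b\<^bsub>-p^k\<^esub>\<close> and carried back to \<open>1/b\<close> by the functional equation, these forms yield approximations to
\<open>F(1/b)\<close> that are dense enough to bound the irrationality exponent by \<open>2 + 4/N\<close> for every \<open>N\<close>.
Transcendence follows by Mahler's method: the functional equation shows that \<open>F\<close> is transcendental over
the rational functions, so that a polynomial in \<open>z\<close> and \<open>F\<close> with high order of vanishing
specializes to nonzero values violating a Liouville inequality at \<open>F(1/b)\<close>.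
\<close>

section \<open>Hankel systems over boolean rings\<close>

text \<open>The relation doubles indices while \<open>F\<close> comes from multiplication by
  \<open>p\<close>. The two are compatible because \<open>p\<close> is odd: a multiple of
  \<open>p\<close> separates \<open>2 * m + 1\<close> from \<open>2 * m + 2\<close> exactly when one
  separates \<open>m\<close> from \<open>m + 1\<close>. Exactness of the order \<open>2 n\<close>
  bounds each linear form from below as well as from above. A candidate fraction
  \<open>u / v\<close> at which the form vanishes is then handled by the lower bound, and no second,
  independent form is needed. Nonsingularity is wanted for every \<open>n\<close>: for a single
  \<open>n\<close> the sizes at successive \<open>k\<close> differ by the power \<open>p\<close>,
  too far apart for exponent 2, and only a whole interval of indices \<open>n\<close> fills these
  gaps. In the transcendence part the order of quantifiers is the obstacle: the exponent in the
  Liouville inequality must not depend on the degree of the polynomial in \<open>F(1/b)\<close>,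
  since that degree is chosen after the exponent.\<close>

lemma underdetermined_system:
  fixes c :: "nat \<Rightarrow> 'i \<Rightarrow> 'a::idom"
  assumes "finite I" "n < card I"
  shows "\<exists>x. (\<exists>i\<in>I. x i \<noteq> 0) \<and> (\<forall>k<n. (\<Sum>i\<in>I. c k i * x i) = 0)"
  using assms
proof (induction n arbitrary: I c)
  case 0
  then have "I \<noteq> {}" by auto
  then show ?case by (intro exI[of _ "\<lambda>_. 1"]) auto
next
  case (Suc n)
  show ?case
  proof (cases "\<forall>i\<in>I. c n i = 0")
    case True
    obtain x where x: "\<exists>i\<in>I. x i \<noteq> 0" "\<forall>k<n. (\<Sum>i\<in>I. c k i * x i) = 0"
      using Suc.IH[of I c] Suc.prems by auto
    with True show ?thesis by (intro exI[of _ x]) (auto simp: less_Suc_eq)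
  next
    case False
    then obtain i0 where i0: "i0 \<in> I" "c n i0 \<noteq> 0" by auto
    define J where "J = I - {i0}"
    have J: "finite J" "n < card J" "i0 \<notin> J" "I = insert i0 J"
      using Suc.prems i0 by (auto simp: J_def)
    obtain x where x: "\<exists>i\<in>J. x i \<noteq> 0"
      "\<forall>k<n. (\<Sum>i\<in>J. (c n i0 * c k i - c k i0 * c n i) * x i) = 0"
      using Suc.IH[OF J(1,2), of "\<lambda>k i. c n i0 * c k i - c k i0 * c n i"] by blast
    \<comment> \<open>Cross-multiplication replaces division: the unknown \<open>i0\<close> is
      solved from equation \<open>n\<close> after all other unknowns are scaled by the pivot
      \<open>c n i0\<close>.\<close>
    define y where "y = (\<lambda>i. if i = i0 then - (\<Sum>j\<in>J. c n j * x j) else c n i0 * x i)"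
    have "(\<Sum>i\<in>I. c k i * y i) = (\<Sum>i\<in>J. (c n i0 * c k i - c k i0 * c n i) * x i)" for k
    proof -
      have "(\<Sum>i\<in>I. c k i * y i) = c k i0 * y i0 + (\<Sum>i\<in>J. c k i * y i)"
        using J by simp
      also have "(\<Sum>i\<in>J. c k i * y i) = (\<Sum>i\<in>J. c n i0 * c k i * x i)"
        using J(3) by (intro sum.cong) (auto simp: y_def)
      also have "c k i0 * y i0 = (\<Sum>i\<in>J. - (c k i0 * c n i * x i))"
        by (simp add: y_def sum_distrib_left sum_negf mult.assoc)
      finally show ?thesis by (simp add: sum.distrib[symmetric] algebra_simps)
    qed
    moreover have "\<exists>i\<in>I. y i \<noteq> 0"
      using x(1) J(3,4) i0(2) by (auto simp: y_def)
    ultimately show ?thesis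
      using x(2) by (intro exI[of _ y]) (auto simp: less_Suc_eq mult.commute)
  qed
qed

lemma boolean_double:
  fixes x :: "'a::comm_ring_1"
  assumes "\<And>x::'a. x * x = x"
  shows "x + x = 0"
proof -
  have "(x + x) * (x + x) = x + x" by (rule assms)
  then have "4 * (x * x) = 2 * x" by (simp add: algebra_simps)
  then show ?thesis by (simp add: assms)
qed

text \<open>Off-diagonal terms come in equal pairs, which cancel since \<open>x + x = 0\<close>, and
  idempotence makes the diagonal terms linear in \<open>q\<close>.\<close>

lemma boolean_symmetric_sum:
  fixes q s :: "nat \<Rightarrow> 'a::comm_ring_1"
  assumes idem: "\<And>x::'a. x * x = x"
  shows "(\<Sum>i\<le>m. q i * (\<Sum>j\<le>m. q j * s (i + j))) = (\<Sum>i\<le>m. q i * s (2 * i))"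
proof (induction m)
  case 0
  then show ?case by (simp add: idem mult.assoc[symmetric])
next
  case (Suc m)
  define R where "R = (\<Sum>i\<le>m. q i * (q (Suc m) * s (i + Suc m)))"
  have "(\<Sum>i\<le>Suc m. q i * (\<Sum>j\<le>Suc m. q j * s (i + j)))
     = (\<Sum>i\<le>m. q i * (\<Sum>j\<le>m. q j * s (i + j))) + (R + R)
       + q (Suc m) * (q (Suc m) * s (Suc m + Suc m))"
    by (simp add: R_def algebra_simps sum.distrib sum_distrib_left)
  also have "R + R = 0" by (rule boolean_double[OF idem])
  also have "q (Suc m) * (q (Suc m) * s (Suc m + Suc m)) = q (Suc m) * s (2 * Suc m)"
    by (simp add: idem mult.assoc[symmetric] mult_2)
  finally show ?case by (simp add: Suc)
qed

text \<open>The quadratic form \<open>\<Sum> q\<^sub>i q\<^sub>j s(i + j)\<close> is diagonal in characteristic 2. Evaluating it for \<open>h\<close> and for \<open>h\<close>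
  shifted by one gives \<open>a c = a + c\<close>, hence \<open>a = c = 0\<close>, for \<open>a = q\<^sub>0\<close> and \<open>c = \<Sum> q\<^bsub>i+1\<^esub> h\<^sub>i\<close>; then \<open>q\<close> can be
  shifted down.\<close>

lemma boolean_hankel_nonsingular:
  fixes h q :: "nat \<Rightarrow> 'a::comm_ring_1"
  assumes idem: "\<And>x::'a. x * x = x"
    and h0: "h 0 = 1" and rec: "\<And>i. h (2 * i + 1) + h (2 * i + 2) = h i"
    and "\<And>j. j \<le> m \<Longrightarrow> (\<Sum>i\<le>m. q i * h (i + j)) = 0" and "i \<le> m"
  shows "q i = 0"
  using assms(4,5)
proof (induction m arbitrary: q i)
  case (0 q i)
  then show ?case using h0 by (auto dest: spec[of _ 0])
next
  case (Suc m q i)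
  \<comment> \<open>\<open>s\<close> is \<open>h\<close> moved up one place with 0 in front, so row
    \<open>Suc k\<close> of its Hankel matrix is row \<open>k\<close> of that of \<open>h\<close>.
    Only row 0 is not known to annihilate \<open>q\<close>; its value is \<open>c\<close>.\<close>
  define s where "s = (\<lambda>k. if k = 0 then 0 else h (k - 1))"
  define c where "c = (\<Sum>j\<le>Suc m. q j * s j)"
  have "(\<Sum>i\<le>Suc m. q i * h (2 * i)) = (\<Sum>i\<le>Suc m. q i * (\<Sum>j\<le>Suc m. q j * h (i + j)))"
    by (rule boolean_symmetric_sum[OF idem, symmetric])
  also have "\<dots> = 0"
    by (intro sum.neutral) (use Suc.prems(1) in \<open>simp add: add.commute\<close>)
  finally have e1: "(\<Sum>i\<le>Suc m. q i * h (2 * i)) = 0" .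
  have "(\<Sum>i\<le>Suc m. q i * s (2 * i)) = (\<Sum>i\<le>Suc m. q i * (\<Sum>j\<le>Suc m. q j * s (i + j)))"
    by (rule boolean_symmetric_sum[OF idem, symmetric])
  also have "\<dots> = (\<Sum>i\<le>Suc m. if i = 0 then q 0 * c else 0)"
  proof (intro sum.cong refl)
    fix k assume k: "k \<in> {..Suc m}"
    show "q k * (\<Sum>j\<le>Suc m. q j * s (k + j)) = (if k = 0 then q 0 * c else 0)"
    proof (cases k)
      case 0
      then show ?thesis by (simp add: c_def)
    next
      case (Suc k')
      then have "(\<Sum>j\<le>Suc m. q j * s (k + j)) = (\<Sum>j\<le>Suc m. q j * h (j + k'))"
        by (simp add: s_def add.commute)
      also have "\<dots> = 0" using Suc k by (intro Suc.prems(1)) auto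
      finally show ?thesis using Suc by simp
    qed
  qed
  also have "\<dots> = q 0 * c" by simp
  finally have e2: "(\<Sum>i\<le>Suc m. q i * s (2 * i)) = q 0 * c" .
  \<comment> \<open>The two diagonals are added because \<open>rec\<close> reads
    \<open>s (2 * k) + h (2 * k) = s k\<close> for \<open>k > 0\<close>; the exceptional index 0
    contributes \<open>q 0\<close>.\<close>
  have "q 0 * c = (\<Sum>i\<le>Suc m. q i * (s (2 * i) + h (2 * i)))"
    using e1 e2 by (simp add: distrib_left sum.distrib)
  also have "\<dots> = (\<Sum>i\<le>Suc m. q i * s i + (if i = 0 then q 0 else 0))"
  proof (intro sum.cong refl)
    fix k
    have "s (2 * k) + h (2 * k) = s k" if "k \<noteq> 0"
    proof -
      from that obtain k' where "k = Suc k'" by (cases k) auto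
      then show ?thesis using rec[of k'] by (simp add: s_def)
    qed
    then show "q k * (s (2 * k) + h (2 * k)) = q k * s k + (if k = 0 then q 0 else 0)"
      by (simp add: s_def h0)
  qed
  also have "\<dots> = c + q 0" by (simp add: sum.distrib c_def)
  finally have main: "q 0 * c = c + q 0" .
  have "q 0 * (q 0 * c) = q 0 * c + q 0" by (subst main) (simp add: algebra_simps idem)
  then have q0: "q 0 = 0" by (simp add: mult.assoc[symmetric] idem)
  with main have c0: "c = 0" by simp
  \<comment> \<open>Since \<open>q 0 = 0\<close>, the shifted vector solves the smaller system: its
    equation 0 is \<open>c = 0\<close>, its equation \<open>Suc j'\<close> is equation
    \<open>j'\<close> of the given one.\<close>
  have "q (Suc k) = 0" if "k \<le> m" for k
  proof (rule Suc.IH[OF _ that, of "\<lambda>i. q (Suc i)"])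
    fix j assume j: "j \<le> m"
    show "(\<Sum>i\<le>m. q (Suc i) * h (i + j)) = 0"
    proof (cases j)
      case 0
      then show ?thesis using c0 by (simp add: c_def sum.atMost_Suc_shift s_def q0 del: sum.atMost_Suc)
    next
      case (Suc j')
      then show ?thesis using Suc.prems(1)[of j'] j
        by (simp add: sum.atMost_Suc_shift q0 del: sum.atMost_Suc)
    qed
  qed
  with q0 Suc.prems(2) show ?case by (cases i) auto
qed

lemma summation_by_parts:
  fixes d \<gamma> :: "nat \<Rightarrow> 'a::comm_ring_1"
  shows "(\<Sum>i\<le>m. d i * \<gamma> i)
    = (\<Sum>i<m. (\<Sum>k\<le>i. d k) * (\<gamma> i - \<gamma> (Suc i))) + (\<Sum>k\<le>m. d k) * \<gamma> m"
  by (induction m) (simp_all add: algebra_simps)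

text \<open>By Abel summation the partial sums of \<open>d\<close> are killed by the Hankel matrix
  of the differences of \<open>\<gamma>\<close>; \<open>total\<close> removes the boundary term. The
  condition on \<open>\<gamma>\<close> telescopes to the recurrence for these differences. In the
  application \<open>\<gamma> j\<close> tells whether the signs at \<open>j\<close> and
  \<open>j + 1\<close> differ.\<close>

lemma boolean_hankel_kernel:
  fixes d \<gamma> :: "nat \<Rightarrow> 'a::comm_ring_1"
  assumes idem: "\<And>x::'a. x * x = x"
    and \<gamma>: "\<And>i. \<gamma> (2 * i + 1) = 1 - \<gamma> i"
    and total: "(\<Sum>i\<le>m. d i) = 0"
    and orth: "\<And>j. j < m \<Longrightarrow> (\<Sum>i\<le>m. d i * \<gamma> (i + j)) = 0" and "i \<le> m"
  shows "d i = 0"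
proof (cases m)
  case 0
  then show ?thesis using total \<open>i \<le> m\<close> by simp
next
  case (Suc n)
  define s where "s = (\<lambda>i. \<Sum>k\<le>i. d k)"
  define h where "h = (\<lambda>j. \<gamma> j - \<gamma> (Suc j))"
  have dbl: "x + x = 0" for x :: 'a by (rule boolean_double[OF idem])
  have sm: "s m = 0" using total by (simp add: s_def)
  have "s k = 0" if "k \<le> n" for k
  proof (rule boolean_hankel_nonsingular[OF idem _ _ _ that, of h])
    have "\<gamma> 1 = 1 - \<gamma> 0" using \<gamma>[of 0] by simp
    then have "h 0 = (\<gamma> 0 + \<gamma> 0) + 1 - (1 + 1)" by (simp add: h_def algebra_simps)
    then show "h 0 = 1" by (simp only: dbl) simp
    show "h (2 * i + 1) + h (2 * i + 2) = h i" for i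
    proof -
      have "h (2 * i + 1) + h (2 * i + 2) = \<gamma> (2 * i + 1) - \<gamma> (2 * Suc i + 1)"
        by (simp add: h_def)
      also have "\<dots> = (h i + h i) - (h i + h i) - h i" unfolding \<gamma> by (simp add: h_def)
      also have "\<dots> = h i" using dbl[of "h i"] by (simp add: add_eq_0_iff)
      finally show ?thesis .
    qed
    fix j assume "j \<le> n"
    then have "(\<Sum>i\<le>m. d i * \<gamma> (i + j)) = 0" using orth[of j] Suc by simp
    then show "(\<Sum>i\<le>n. s i * h (i + j)) = 0"
      using summation_by_parts[of d "\<lambda>i. \<gamma> (i + j)" m] sm
      by (simp add: s_def h_def Suc lessThan_Suc_atMost)
  qed
  then have "s k = 0" if "k \<le> m" for k using sm that Suc by (cases "k = m") auto
  moreover have "d i = s i - (if i = 0 then 0 else s (i - 1))"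
    by (cases i) (simp_all add: s_def)
  ultimately show ?thesis using \<open>i \<le> m\<close> by simp
qed

section \<open>Integer sign sequences modulo 2\<close>

lemma of_int_bit_eq_0_iff: "(of_int n :: bit) = 0 \<longleftrightarrow> even n"
proof
  assume "(of_int n :: bit) = 0"
  then have "odd n \<Longrightarrow> False" by (auto elim!: oddE)
  then show "even n" by blast
qed (auto elim!: evenE)

text \<open>The determinants themselves are divisible by large powers of 2. Dividing the differences of
  consecutive equations by 2 leaves a system that is nonsingular modulo 2.\<close>

lemma sign_hankel_even:
  fixes f q :: "nat \<Rightarrow> int"
  assumes sign: "\<And>i. f i = 1 \<or> f i = -1"
    and T: "\<And>m. f (2 * m + 1) * f (2 * m + 2) * f m * f (m + 1) = -1"
    and orth: "\<And>j. j \<le> m \<Longrightarrow> (\<Sum>i\<le>m. q i * f (i + j)) = 0" and "i \<le> m"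
  shows "even (q i)"
proof -
  \<comment> \<open>\<open>g j\<close> is odd exactly at a sign change between \<open>j\<close> and
    \<open>Suc j\<close>. In these terms \<open>T\<close> says that exactly one of
    \<open>g k\<close> and \<open>g (2 * k + 1)\<close> is odd.\<close>
  define g where "g = (\<lambda>j. (f (Suc j) - f j) div 2)"
  have g: "f (Suc j) = f j + 2 * g j" for j
    using sign[of j] sign[of "Suc j"] by (auto simp: g_def)
  have godd: "odd (g j) \<longleftrightarrow> f j * f (Suc j) = -1" for j
    using sign[of j] sign[of "Suc j"] by (auto simp: g_def)
  have fbit: "(of_int (f j) :: bit) = 1" for j using sign[of j] by auto
  have idem: "x * x = x" for x :: bit by (cases x) simp_all
  have "(of_int (q i) :: bit) = 0"
  proof (rule boolean_hankel_kernel[OF idem _ _ _ \<open>i \<le> m\<close>,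
        of "\<lambda>j. of_int (g j)" "\<lambda>j. of_int (q j)"])
    fix k :: nat
    have "f (2 * k + 1) * f (2 * k + 2) = - (f k * f (k + 1))"
      using T[of k] sign[of k] sign[of "k + 1"] by auto
    then have "even (1 - g k - g (2 * k + 1))"
      using godd[of k] godd[of "2 * k + 1"] sign[of k] sign[of "Suc k"] by auto
    then have "(of_int (1 - g k - g (2 * k + 1)) :: bit) = 0"
      by (subst of_int_bit_eq_0_iff)
    then show "of_int (g (2 * k + 1)) = (1 - of_int (g k) :: bit)"
      unfolding of_int_diff of_int_1 by (metis right_minus_eq)
  next
    \<comment> \<open>Modulo 2 all signs are 1, so every equation reduces to this one; what is lost
      is recovered from the halved differences below.\<close>
    have "(0 :: bit) = of_int (\<Sum>i\<le>m. q i * f (i + 0))" using orth[of 0] by simp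
    also have "\<dots> = (\<Sum>i\<le>m. of_int (q i))"
      unfolding of_int_sum of_int_mult fbit mult_1_right ..
    finally show "(\<Sum>i\<le>m. of_int (q i) :: bit) = 0" by (rule sym)
  next
    fix j assume "j < m"
    then have "0 = (\<Sum>i\<le>m. q i * f (i + Suc j)) - (\<Sum>i\<le>m. q i * f (i + j))"
      using orth[of j] orth[of "Suc j"] by simp
    also have "\<dots> = 2 * (\<Sum>i\<le>m. q i * g (i + j))"
      by (simp add: g algebra_simps sum.distrib sum_distrib_left)
    finally have "(of_int (\<Sum>i\<le>m. q i * g (i + j)) :: bit) = 0" by simp
    then show "(\<Sum>i\<le>m. of_int (q i) * of_int (g (i + j)) :: bit) = 0"
      unfolding of_int_sum of_int_mult .
  qed
  then show ?thesis by (simp only: of_int_bit_eq_0_iff)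
qed

text \<open>Infinite descent: a kernel vector has even entries, and its half is again a kernel
  vector, with a smaller sum of absolute values unless it is zero.\<close>

lemma sign_hankel_nonsingular:
  fixes f q :: "nat \<Rightarrow> int"
  assumes sign: "\<And>i. f i = 1 \<or> f i = -1"
    and T: "\<And>m. f (2 * m + 1) * f (2 * m + 2) * f m * f (m + 1) = -1"
    and "\<And>j. j \<le> m \<Longrightarrow> (\<Sum>i\<le>m. q i * f (i + j)) = 0" and "i \<le> m"
  shows "q i = 0"
  using assms(3,4)
proof (induction "nat (\<Sum>i\<le>m. \<bar>q i\<bar>)" arbitrary: q i rule: less_induct)
  case less
  have ev: "even (q k)" if "k \<le> m" for k
    by (rule sign_hankel_even[OF sign T less.prems(1) that])
  show ?case
  proof (rule ccontr)
    assume nz: "q i \<noteq> 0"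
    have "q i div 2 = 0"
    proof (rule less.hyps[of "\<lambda>k. q k div 2", OF _ _ less.prems(2)])
      have "(\<Sum>i\<le>m. \<bar>q i div 2\<bar>) < (\<Sum>i\<le>m. \<bar>q i\<bar>)"
      proof (rule sum_strict_mono_ex1)
        show "\<forall>x\<in>{..m}. \<bar>q x div 2\<bar> \<le> \<bar>q x\<bar>" using ev by (auto elim!: evenE)
        show "\<exists>a\<in>{..m}. \<bar>q a div 2\<bar> < \<bar>q a\<bar>"
          using ev[OF less.prems(2)] nz less.prems(2) by (intro bexI[of _ i]) (auto elim!: evenE)
      qed simp
      then show "nat (\<Sum>i\<le>m. \<bar>q i div 2\<bar>) < nat (\<Sum>i\<le>m. \<bar>q i\<bar>)"
        by (subst nat_mono_iff) (auto intro: order.strict_trans1[rotated] sum_nonneg)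
    next
      fix j assume "j \<le> m"
      have "2 * (\<Sum>i\<le>m. q i div 2 * f (i + j)) = (\<Sum>i\<le>m. q i * f (i + j))"
        unfolding sum_distrib_left using ev by (intro sum.cong) (auto simp: mult.assoc[symmetric])
      then show "(\<Sum>i\<le>m. q i div 2 * f (i + j)) = 0"
        using less.prems(1)[OF \<open>j \<le> m\<close>] by simp
    qed
    then show False using ev[OF less.prems(2)] nz by (auto elim!: evenE)
  qed
qed

section \<open>Coefficients of the Mahler product\<close>

unbundle no vec_syntax

text \<open>Only the remainder of \<open>n\<close> modulo \<open>p\<close> can be the exponent taken
  from \<open>A\<close>: multiplication by \<open>A\<close> prepends a last base-\<open>p\<close>
  digit.\<close>

lemma fps_mult_compose_X_power_nth:
  fixes A G :: "'a::idom fps"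
  assumes A: "\<And>i. i \<ge> p \<Longrightarrow> A $ i = 0" and p: "p > 0"
  shows "(A * (G oo fps_X ^ p)) $ n = A $ (n mod p) * G $ (n div p)"
proof -
  have "(A * (G oo fps_X ^ p)) $ n
      = (\<Sum>i=0..n. A $ i * (if p dvd n - i then G $ ((n - i) div p) else 0))"
    by (simp only: fps_mult_nth fps_nth_compose_X_power)
  also have "\<dots> = (\<Sum>i=0..n. if i = n mod p then A $ (n mod p) * G $ (n div p) else 0)"
  proof (intro sum.cong refl)
    fix i assume i: "i \<in> {0..n}"
    show "A $ i * (if p dvd n - i then G $ ((n - i) div p) else 0)
        = (if i = n mod p then A $ (n mod p) * G $ (n div p) else 0)"
    proof (cases "i < p \<and> p dvd n - i")
      case True
      then obtain k where "n - i = p * k" by (auto elim: dvdE)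
      with i have n: "n = i + p * k" by simp
      have "n mod p = i" "n div p = k" using True p by (simp_all add: n)
      then show ?thesis using True \<open>n - i = p * k\<close> p by simp
    next
      case False
      then have "i \<noteq> n mod p" using p by auto
      with False A show ?thesis by (auto simp: not_less)
    qed
  qed
  also have "\<dots> = A $ (n mod p) * G $ (n div p)" by simp
  finally show ?thesis .
qed

lemma coeff_mult_pcompose_monom:
  fixes A B :: "'a::idom poly"
  assumes "degree A < p"
  shows "coeff (A * pcompose B (monom 1 p)) n = coeff A (n mod p) * coeff B (n div p)"
proof -
  have "fps_of_poly (A * pcompose B (monom 1 p))
      = fps_of_poly A * (fps_of_poly B oo fps_X ^ p)"
    using assms by (simp add: fps_of_poly_mult fps_of_poly_pcompose fps_of_poly_monom')
  from arg_cong[OF this, of "\<lambda>G. G $ n"] show ?thesis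
    using assms by (subst (asm) fps_mult_compose_X_power_nth) (auto intro: coeff_eq_0)
qed

lemma pcompose_monom_monom:
  "pcompose (monom 1 k) (monom 1 p) = monom (1::'a::comm_semiring_1) (p * k)"
proof (induction k)
  case 0
  then show ?case by (simp add: monom_0)
next
  case (Suc k)
  then show ?case by (simp add: monom_Suc[of 1 k] pcompose_pCons mult_monom)
qed

section \<open>Base-\<open>p\<close> digits and the doubling relation\<close>

definition poly_prod :: "nat \<Rightarrow> int poly \<Rightarrow> nat \<Rightarrow> int poly" where
  "poly_prod p P N = (\<Prod>k<N. pcompose P (monom 1 (p ^ k)))"

lemma poly_prod_Suc: "poly_prod p P (Suc N) = P * pcompose (poly_prod p P N) (monom 1 p)"
proof -
  have "monom 1 (Suc 0) = [:0, 1::int:]" by (simp add: monom_Suc)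
  then have "pcompose P (monom 1 (p ^ 0)) = P" by simp
  moreover have "pcompose P (monom 1 (p ^ Suc k)) = pcompose (pcompose P (monom 1 (p ^ k))) (monom 1 p)" for k
    by (simp add: pcompose_assoc[symmetric] pcompose_monom_monom)
  ultimately show ?thesis
    unfolding poly_prod_def by (simp add: prod.lessThan_Suc_shift pcompose_prod del: prod.lessThan_Suc power_Suc)
qed

text \<open>The digit relation leaves out \<open>r = p - 1\<close>, the digit at which
  \<open>m + 1\<close> carries; there the relation for \<open>m\<close> is the one for
  \<open>m div p\<close>. The initial coefficients 1, -1, -1 also serve to exclude polynomial
  solutions of \<open>U(z^p) = P(z)^d U(z)\<close>.\<close>

locale sign_mahler =
  fixes p :: nat and P :: "int poly"
  assumes p_odd: "odd p" and p_ge: "p \<ge> 3"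
    and degree_P: "degree P = p - 1"
    and coeff_sign: "\<And>i. i < p \<Longrightarrow> coeff P i = 1 \<or> coeff P i = -1"
    and coeff_init: "coeff P 0 = 1" "coeff P 1 = -1" "coeff P 2 = -1"
    and digit_relation: "\<And>r. r < p - 1 \<Longrightarrow>
      coeff P ((2 * r + 1) mod p) * coeff P ((2 * r + 2) mod p) * coeff P r * coeff P (r + 1) = -1"
begin

definition f :: "nat \<Rightarrow> int" where "f n = fps_nth (mahler_prod_fps p P) n"

lemma degree_P_less: "degree P < p"
  using degree_P p_ge by simp

lemma coeff_poly_prod_Suc:
  "coeff (poly_prod p P (Suc N)) n = coeff P (n mod p) * coeff (poly_prod p P N) (n div p)"
  unfolding poly_prod_Suc by (rule coeff_mult_pcompose_monom[OF degree_P_less])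

lemma coeff_poly_prod_stable:
  "n < p ^ N \<Longrightarrow> coeff (poly_prod p P (Suc N)) n = coeff (poly_prod p P N) n"
proof (induction N arbitrary: n)
  case 0
  then show ?case unfolding coeff_poly_prod_Suc by (simp add: coeff_init poly_prod_def)
next
  case (Suc N)
  then have "n div p < p ^ N" by (simp add: less_mult_imp_div_less mult.commute)
  then have "coeff (poly_prod p P (Suc N)) (n div p) = coeff (poly_prod p P N) (n div p)"
    by (rule Suc.IH)
  then show ?case
    unfolding coeff_poly_prod_Suc[of "Suc N"] coeff_poly_prod_Suc[of N n] by simp
qed

lemma less_power_self: "n < p ^ n"
  using p_ge by (intro power_gt_expt) simp

lemma f_eq_coeff: "n < p ^ N \<Longrightarrow> f n = coeff (poly_prod p P N) n"
proof -
  have *: "coeff (poly_prod p P (N + k)) n = coeff (poly_prod p P N) n" if "n < p ^ N" for N k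
  proof (induction k)
    case (Suc k)
    have "n < p ^ (N + k)"
      using that p_ge by (intro less_le_trans[OF that] power_increasing) auto
    with Suc coeff_poly_prod_stable show ?case by simp
  qed simp
  have n: "n < p ^ Suc n" using less_power_self[of "Suc n"] by simp
  assume "n < p ^ N"
  then have "coeff (poly_prod p P (N + Suc n)) n = coeff (poly_prod p P N) n" by (rule *)
  moreover have "coeff (poly_prod p P (Suc n + N)) n = coeff (poly_prod p P (Suc n)) n"
    by (rule *[OF n])
  ultimately show ?thesis
    by (simp add: f_def mahler_prod_fps_def poly_prod_def add.commute)
qed

lemma f_rec: "f n = coeff P (n mod p) * f (n div p)"
proof -
  define N where "N = n"
  have N: "n < p ^ N" unfolding N_def by (rule less_power_self)
  have "p ^ N \<le> p ^ Suc N" using p_ge by (intro power_increasing) auto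
  with N have "n < p ^ Suc N" by (rule less_le_trans)
  then have "f n = coeff (poly_prod p P (Suc N)) n" by (rule f_eq_coeff)
  also have "\<dots> = coeff P (n mod p) * coeff (poly_prod p P N) (n div p)"
    by (rule coeff_poly_prod_Suc)
  also have "coeff (poly_prod p P N) (n div p) = f (n div p)"
    by (rule f_eq_coeff[symmetric]) (use N in \<open>meson div_le_dividend order.strict_trans1\<close>)
  finally show ?thesis .
qed

lemma f_0 [simp]: "f 0 = 1"
  using f_eq_coeff[of 0 0] by (simp add: poly_prod_def)

lemma f_digit: "r < p \<Longrightarrow> f (p * m + r) = coeff P r * f m"
  by (subst f_rec) simp

lemma f_sign: "f n = 1 \<or> f n = -1"
proof (induction n rule: less_induct)
  case (less n)
  show ?case
  proof (cases "n = 0")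
    case False
    then have "n div p < n" using p_ge by simp
    then have "f (n div p) = 1 \<or> f (n div p) = -1" by (rule less)
    then show ?thesis using coeff_sign[of "n mod p"] p_ge f_rec[of n] by auto
  qed simp
qed

lemma f_square: "f n * f n = 1"
  using f_sign[of n] by auto

lemma f_relation: "f (2 * m + 1) * f (2 * m + 2) * f m * f (m + 1) = -1"
proof (induction m rule: less_induct)
  case (less m)
  define r k where "r = m mod p" and "k = m div p"
  have m: "m = p * k + r" and r: "r < p" using p_ge by (auto simp: r_def k_def)
  show ?case
  proof (cases "r = p - 1")
    case True
    \<comment> \<open>Both \<open>m + 1\<close> and \<open>2 * m + 2\<close> carry. The sign
      \<open>coeff P r\<close> occurs twice and the digit 0 contributes
      \<open>coeff P 0 = 1\<close>, so the relation for \<open>k\<close> remains.\<close>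
    have "f (2 * m + 1) = f (p * (2 * k + 1) + r)"
      by (rule arg_cong[of _ _ f]) (use True p_ge in \<open>simp add: m algebra_simps\<close>)
    moreover have "f (2 * m + 2) = f (p * (2 * k + 2) + 0)"
      by (rule arg_cong[of _ _ f]) (use True p_ge in \<open>simp add: m algebra_simps\<close>)
    moreover have "f (m + 1) = f (p * (k + 1) + 0)"
      by (rule arg_cong[of _ _ f]) (use True p_ge in \<open>simp add: m algebra_simps\<close>)
    moreover have "f m = f (p * k + r)" by (simp add: m)
    moreover have "m \<noteq> 0" using True p_ge by (auto simp: m)
    then have "k < m" using p_ge by (simp add: k_def)
    ultimately show ?thesis
      using less[of k] coeff_sign[OF r] r p_ge f_digit[of 0 "2 * k + 2"] f_digit[of 0 "k + 1"]
        f_digit[of r "2 * k + 1"] f_digit[of r k]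
      by (auto simp: coeff_init)
  next
    case False
    then have r1: "r + 1 < p" using r by simp
    have fm: "f m = coeff P r * f k" "f (m + 1) = coeff P (r + 1) * f k"
      using f_digit[OF r, of k] f_digit[OF r1, of k] by (simp_all add: m)
    \<comment> \<open>As \<open>p\<close> is odd, \<open>2 * r + 2\<close> is not \<open>p\<close>,
      so both indices have the same leading part \<open>l\<close>. Hence \<open>f l\<close> and
      \<open>f k\<close> enter as squares and only the digit signs are left.\<close>
    obtain l where "f (2 * m + 1) = coeff P ((2 * r + 1) mod p) * f l"
      "f (2 * m + 2) = coeff P ((2 * r + 2) mod p) * f l"
    proof (cases "2 * r + 2 < p")
      case True
      then show ?thesis
        using f_digit[of "2 * r + 1" "2 * k"] f_digit[of "2 * r + 2" "2 * k"]
        by (intro that[of "2 * k"]) (simp_all add: m algebra_simps)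
    next
      case False
      moreover have "2 * r + 2 \<noteq> p" using p_odd by auto
      ultimately have *: "2 * r + 1 \<ge> p" by simp
      then obtain s where s: "2 * r + 1 = p + s" by (metis le_Suc_ex)
      with r1 have s': "s + 1 < p" by simp
      have s2: "2 * r + 2 = p + (s + 1)" using s by simp
      have "2 * m + 1 = p * (2 * k + 1) + s" "2 * m + 2 = p * (2 * k + 1) + (s + 1)"
        using s by (simp_all add: m algebra_simps)
      moreover have "(2 * r + 1) mod p = s" "(2 * r + 2) mod p = s + 1"
        using s s' mod_add_self1[of p s] mod_add_self1[of p "s + 1"] unfolding s s2 by simp_all
      ultimately show ?thesis
        using f_digit[of s "2 * k + 1"] f_digit[OF s', of "2 * k + 1"] s'
        by (intro that[of "2 * k + 1"]) simp_all
    qed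
    then have "f (2 * m + 1) * f (2 * m + 2) * f m * f (m + 1)
       = (coeff P ((2 * r + 1) mod p) * coeff P ((2 * r + 2) mod p) * coeff P r * coeff P (r + 1))
         * (f l * f l) * (f k * f k)"
      by (simp only: fm mult_ac)
    also have "\<dots> = -1"
      using digit_relation[of r] r1 by (simp add: f_square)
    finally show ?thesis .
  qed
qed

lemma hankel_nonsingular:
  assumes "\<And>j. j \<le> m \<Longrightarrow> (\<Sum>i\<le>m. q i * f (i + j)) = 0" "i \<le> m"
  shows "q i = 0"
  by (rule sign_hankel_nonsingular[OF f_sign f_relation assms])

end

section \<open>Transcendence of the power series\<close>

lemma pcompose_power: "pcompose (A ^ n) B = pcompose A B ^ n"
  for A B :: "'a::comm_semiring_1 poly"
  by (induction n) (simp_all add: pcompose_1 pcompose_mult)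

lemma order_power: "A \<noteq> 0 \<Longrightarrow> order z (A ^ n) = n * order z A"
  for A :: "'a::idom poly"
  by (induction n) (simp_all add: order_mult order_0I)

lemma order_X_power_minus_power:
  fixes z :: complex
  assumes "z \<noteq> 0" "p > 0"
  shows "order z (monom 1 p + [:- (z ^ p):]) = 1"
proof -
  let ?Z = "monom 1 p + [:- (z ^ p):]"
  have d: "pderiv ?Z = monom (of_nat p) (p - 1)"
    by (simp add: pderiv_add pderiv_monom pderiv_pCons)
  have "order z (pderiv ?Z) = 0"
    unfolding d by (rule order_0I) (use assms in \<open>simp add: poly_monom\<close>)
  moreover have "?Z \<noteq> 0"
  proof
    assume "?Z = 0"
    then have "pderiv ?Z = 0" by simp
    then show False unfolding d using assms by simp
  qed
  moreover have "poly ?Z z = 0" by (simp add: poly_monom)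
  ultimately show ?thesis using order_pderiv[of ?Z z] by simp
qed

context sign_mahler
begin

abbreviation subst_pow :: "complex poly \<Rightarrow> complex poly" where
  "subst_pow A \<equiv> pcompose A (monom 1 p)"

definition Pc :: "complex poly" where "Pc = map_poly of_int P"

definition Fc :: "complex fps" where "Fc = Abs_fps (\<lambda>n. of_int (f n))"

lemma coeff_Pc: "coeff Pc i = of_int (coeff P i)"
  by (simp add: Pc_def coeff_map_poly)

lemma degree_Pc: "degree Pc = p - 1"
  unfolding Pc_def degree_P[symmetric] by (rule degree_map_poly) simp

lemma Pc_nonzero: "Pc \<noteq> 0"
  using degree_Pc p_ge by auto

lemma degree_subst_pow: "degree (subst_pow A) = degree A * p"
  by (simp add: degree_pcompose degree_monom_eq)

lemma subst_pow_eq_0_iff [simp]: "subst_pow A = 0 \<longleftrightarrow> A = 0"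
  using p_ge by (auto simp: pcompose_eq_0_iff degree_monom_eq dest!: pcompose_eq_0)

text \<open>Every root of the polynomial \<open>P\<close> forces a root of \<open>U\<close> of multiplicity \<open>d\<close>, which is the degree
  of \<open>U\<close>; hence \<open>U\<close> is a multiple of \<open>(z - \<rho>)\<^sup>d\<close> and \<open>P\<close> a multiple of \<open>(z\<^sup>p - \<rho>) / (z - \<rho>)\<close>, which
  is incompatible with the initial coefficients 1, -1, -1.\<close>

lemma no_polynomial_solution:
  assumes eq: "subst_pow U = Pc ^ d * U" and U: "U \<noteq> 0" and d: "d > 0"
  shows False
proof -
  have deg_U: "degree U = d"
  proof -
    have "degree U * p = d * (p - 1) + degree U"
      using arg_cong[OF eq, of degree] U Pc_nonzero
      by (simp add: degree_subst_pow degree_mult_eq degree_power_eq degree_Pc)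
    moreover obtain p' where "p = Suc p'" "p' > 0" using p_ge by (cases p) auto
    ultimately show ?thesis by simp
  qed
  have "\<not> constant (poly Pc)"
    using degree_Pc p_ge by (simp add: constant_degree)
  then obtain z where z: "poly Pc z = 0" using fundamental_theorem_of_algebra by blast
  have z0: "z \<noteq> 0"
    using z coeff_Pc[of 0] coeff_init by (auto simp: poly_0_coeff_0)
  define \<rho> where "\<rho> = z ^ p"
  define L where "L = [:- \<rho>, 1:]"
  define Z where "Z = monom 1 p + [:- \<rho>:]"
  have sL: "subst_pow L = Z" by (simp add: L_def Z_def pcompose_pCons)
  obtain w where w: "U = L ^ order \<rho> U * w" "\<not> L dvd w"
    using order_decomp[OF U, of \<rho>] unfolding L_def by blast
  define e where "e = order \<rho> U"
  have w0: "w \<noteq> 0" using w(2) by auto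
  have sU: "subst_pow U = Z ^ e * subst_pow w"
    by (subst w(1)) (simp add: pcompose_mult pcompose_power sL e_def)
  have Z0: "Z \<noteq> 0" using sL by (metis L_def subst_pow_eq_0_iff pCons_eq_0_iff zero_neq_one)
  have "[:- z, 1:] dvd Pc" using z by (simp add: poly_eq_0_iff_dvd)
  then have "[:- z, 1:] ^ d dvd Pc ^ d" by (rule dvd_power_same)
  then have "[:- z, 1:] ^ d dvd subst_pow U" unfolding eq by (rule dvd_mult2)
  then have "d \<le> order z (subst_pow U)" using U by (simp add: order_divides)
  \<comment> \<open>Since \<open>z\<close> is a simple root of \<open>Z\<close>, the multiplicity of
    \<open>z\<close> in \<open>U(z^p)\<close> equals that of \<open>\<rho>\<close> in
    \<open>U\<close>.\<close>
  also have "order z (subst_pow U) = e * order z Z + order z (subst_pow w)"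
    unfolding sU using Z0 w0 by (simp add: order_mult order_power)
  also have "order z Z = 1"
    unfolding Z_def \<rho>_def using z0 p_ge by (intro order_X_power_minus_power) auto
  also have "poly (subst_pow w) z \<noteq> 0"
    using w(2) by (simp add: poly_pcompose poly_monom L_def poly_eq_0_iff_dvd \<rho>_def)
  then have "order z (subst_pow w) = 0" by (rule order_0I)
  finally have "d \<le> e" by simp
  moreover have "degree U = e + degree w"
    using arg_cong[OF w(1), of degree] w0
    by (simp add: degree_mult_eq degree_power_eq L_def e_def)
  ultimately have e: "e = d" "degree w = 0" using deg_U by auto
  then obtain c where c: "w = [:c:]" by (auto elim: degree_eq_zeroE)
  with w0 have c0: "c \<noteq> 0" by simp
  have "Z ^ d * w = Pc ^ d * (L ^ d * w)"
    using eq sU w(1) e by (simp add: c e_def)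
  then have "Z ^ d = (Pc * L) ^ d" using w0 by (simp add: power_mult_distrib)
  then have "(Pc * L) ^ d dvd Z ^ d" by simp
  then have "Pc * L dvd Z" using d by (simp only: pow_divides_pow_iff)
  then obtain k where k: "Z = Pc * L * k" by (auto elim: dvdE)
  then have "k \<noteq> 0" using Z0 by auto
  have "degree Z = p"
    unfolding sL[symmetric] by (simp add: degree_subst_pow L_def)
  moreover have "degree L = 1" "L \<noteq> 0" by (simp_all add: L_def)
  then have "degree Z = (p - 1) + 1 + degree k"
    unfolding k using \<open>k \<noteq> 0\<close> Pc_nonzero by (simp add: degree_mult_eq degree_Pc)
  ultimately have "degree k = 0" using p_ge by simp
  then obtain \<kappa> where \<kappa>: "k = [:\<kappa>:]" by (auto elim: degree_eq_zeroE)
  with \<open>k \<noteq> 0\<close> have \<kappa>0: "\<kappa> \<noteq> 0" by simp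
  have co: "coeff Z (Suc i) = \<kappa> * (coeff Pc i - \<rho> * coeff Pc (Suc i))" for i
    by (simp add: k \<kappa> L_def algebra_simps)
  \<comment> \<open>\<open>Z\<close> has no terms of degree 1 and 2 because
    \<open>p \<ge> 3\<close>; in the product \<open>Pc * L\<close> they vanish only if
    \<open>\<rho>\<close> is both -1 and 1.\<close>
  have "coeff Z 1 = 0" "coeff Z 2 = 0"
    using p_ge by (auto simp: Z_def coeff_pCons split: nat.splits)
  then have "1 + \<rho> = 0" "- 1 + \<rho> = 0"
    using co[of 0] co[of 1] \<kappa>0 coeff_init by (simp_all add: coeff_Pc numeral_2_eq_2)
  then have "(1 + \<rho>) - (- 1 + \<rho>) = 0" by simp
  then show False by simp
qed

text \<open>Here \<open>y = U / V\<close> satisfies \<open>y(z^p) = P(z)^d y(z)\<close>. In lowest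
  terms \<open>u / v\<close>, substitution keeps numerator and denominator coprime by Bezout, so
  \<open>v(z^p)\<close> divides \<open>v\<close>. Degrees force \<open>v\<close> to be constant,
  which is the polynomial case.\<close>

lemma no_rational_solution:
  assumes eq: "U * subst_pow V * Pc ^ d = subst_pow U * V"
    and U: "U \<noteq> 0" and V: "V \<noteq> 0" and d: "d > 0"
  shows False
proof -
  have "gcd U V \<noteq> 0" using U by simp
  then obtain u v where uv: "U = u * gcd U V" "V = v * gcd U V" "coprime u v"
    using gcd_coprime_exists by blast
  define g where "g = gcd U V"
  have Ug: "U = u * g" and Vg: "V = v * g" using uv by (simp_all add: g_def)
  have nz: "g \<noteq> 0" "u \<noteq> 0" "v \<noteq> 0" using Ug Vg U V by auto
  have "(g * subst_pow g) * (u * subst_pow v * Pc ^ d) = (g * subst_pow g) * (subst_pow u * v)"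
    using eq unfolding Ug Vg by (simp add: pcompose_mult mult_ac)
  then have eq': "u * subst_pow v * Pc ^ d = subst_pow u * v" using nz by simp
  have "coprime (subst_pow u) (subst_pow v)"
  proof -
    obtain x y where "x * u + y * v = 1"
      using bezout_coefficients_fst_snd[of u v] uv(3) by (metis coprime_iff_gcd_eq_1)
    then have "subst_pow x * subst_pow u + subst_pow y * subst_pow v = 1"
      by (metis pcompose_1 pcompose_add pcompose_mult)
    then show ?thesis
      by (intro coprimeI) (metis dvd_add dvd_mult)
  qed
  moreover have "subst_pow v dvd subst_pow u * v"
    unfolding eq'[symmetric] by simp
  ultimately have "subst_pow v dvd v"
    by (simp add: coprime_dvd_mult_right_iff coprime_commute)
  then have "degree v * p \<le> degree v"
    using dvd_imp_degree_le[of "subst_pow v" v] nz by (simp add: degree_subst_pow)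
  moreover have "degree v * 3 \<le> degree v * p" using p_ge by (rule mult_le_mono2)
  ultimately have "degree v = 0" by linarith
  then obtain c where c: "v = [:c:]" by (auto elim: degree_eq_zeroE)
  with nz have "c \<noteq> 0" by simp
  have "smult c (Pc ^ d * u) = smult c (subst_pow u)"
    using eq' by (simp add: c pcompose_const mult_ac)
  then have "subst_pow u = Pc ^ d * u" using \<open>c \<noteq> 0\<close> by (metis smult_cancel)
  then show False using no_polynomial_solution nz d by blast
qed

lemma Fc_nth [simp]: "Fc $ n = of_int (f n)"
  by (simp add: Fc_def)

lemma Fc_nonzero: "Fc \<noteq> 0"
  using Fc_nth[of 0] by (metis f_0 fps_zero_nth of_int_1 zero_neq_one)

lemma Fc_functional: "Fc = fps_of_poly Pc * (Fc oo fps_X ^ p)"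
proof (rule fps_ext)
  fix n
  have "(fps_of_poly Pc * (Fc oo fps_X ^ p)) $ n = fps_of_poly Pc $ (n mod p) * Fc $ (n div p)"
    using p_ge by (intro fps_mult_compose_X_power_nth) (auto intro!: coeff_eq_0 simp: degree_Pc)
  then show "Fc $ n = (fps_of_poly Pc * (Fc oo fps_X ^ p)) $ n"
    using f_rec[of n] by (simp add: coeff_Pc)
qed

text \<open>Replace \<open>z\<close> by \<open>z^p\<close>, multiply by \<open>Pc ^ m\<close>, and
  let the functional equation absorb \<open>Pc ^ j\<close> into the \<open>j\<close>-th
  power.\<close>

lemma Fc_substitution:
  assumes "(\<Sum>j\<le>m. fps_of_poly (a j) * Fc ^ j) = 0"
  shows "(\<Sum>j\<le>m. fps_of_poly (subst_pow (a j) * Pc ^ (m - j)) * Fc ^ j) = 0"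
proof -
  define G where "G = Fc oo fps_X ^ p"
  have X0: "(fps_X ^ p :: complex fps) $ 0 = 0" using p_ge by simp
  have sub: "fps_of_poly (subst_pow A) = fps_of_poly A oo fps_X ^ p" for A :: "complex poly"
    using p_ge by (simp add: fps_of_poly_pcompose fps_of_poly_monom')
  have "0 = (\<Sum>j\<le>m. fps_of_poly (a j) * Fc ^ j) oo fps_X ^ p" using assms by simp
  also have "\<dots> = (\<Sum>j\<le>m. fps_of_poly (subst_pow (a j)) * G ^ j)"
    by (simp add: fps_compose_sum_distrib fps_compose_mult_distrib[OF X0]
        fps_compose_power[OF X0] sub G_def)
  finally have "0 = fps_of_poly Pc ^ m * (\<Sum>j\<le>m. fps_of_poly (subst_pow (a j)) * G ^ j)" by simp
  also have "\<dots> = (\<Sum>j\<le>m. fps_of_poly (subst_pow (a j) * Pc ^ (m - j)) * Fc ^ j)"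
    unfolding sum_distrib_left
  proof (intro sum.cong refl)
    fix j assume "j \<in> {..m}"
    then have "fps_of_poly Pc ^ m = fps_of_poly Pc ^ (m - j) * fps_of_poly Pc ^ j"
      by (simp flip: power_add)
    moreover have "Fc ^ j = fps_of_poly Pc ^ j * G ^ j"
      using Fc_functional by (metis G_def power_mult_distrib)
    ultimately show "fps_of_poly Pc ^ m * (fps_of_poly (subst_pow (a j)) * G ^ j)
        = fps_of_poly (subst_pow (a j) * Pc ^ (m - j)) * Fc ^ j"
      by (simp add: fps_of_poly_mult fps_of_poly_power mult_ac)
  qed
  finally show ?thesis by simp
qed

text \<open>A relation with the fewest terms has none: combining it with its image under \<open>z \<mapsto> z\<^sup>p\<close> would
  otherwise cancel a term.\<close>

lemma Fc_transcendental:
  assumes "(\<Sum>j\<le>m. fps_of_poly (a j) * Fc ^ j) = 0" "j \<le> m"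
  shows "a j = 0"
  using assms
proof (induction "card {j. j \<le> m \<and> a j \<noteq> 0}" arbitrary: a j rule: less_induct)
  case less
  define S where "S = {j. j \<le> m \<and> a j \<noteq> 0}"
  have fin: "finite S" by (simp add: S_def)
  show ?case
  proof (cases "\<exists>j1\<in>S. \<exists>j0\<in>S. j0 < j1")
    case True
    then obtain j0 j1 where j: "j0 \<in> S" "j1 \<in> S" "j0 < j1" by auto
    \<comment> \<open>Cross-multiplying the relation with its image cancels the index
      \<open>j1\<close> and creates no new index.\<close>
    define b where "b = (\<lambda>j. a j1 * (subst_pow (a j) * Pc ^ (m - j))
        - subst_pow (a j1) * Pc ^ (m - j1) * a j)"
    have "(\<Sum>j\<le>m. fps_of_poly (b j) * Fc ^ j)
      = fps_of_poly (a j1) * (\<Sum>j\<le>m. fps_of_poly (subst_pow (a j) * Pc ^ (m - j)) * Fc ^ j)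
        - fps_of_poly (subst_pow (a j1) * Pc ^ (m - j1)) * (\<Sum>j\<le>m. fps_of_poly (a j) * Fc ^ j)"
      unfolding b_def sum_distrib_left sum_subtractf[symmetric]
      by (intro sum.cong refl) (simp add: fps_of_poly_mult fps_of_poly_diff fps_of_poly_power algebra_simps)
    also have "\<dots> = 0" using less.prems(1) Fc_substitution[OF less.prems(1)] by simp
    finally have rel: "(\<Sum>j\<le>m. fps_of_poly (b j) * Fc ^ j) = 0" .
    have "b j1 = 0" "\<And>k. a k = 0 \<Longrightarrow> b k = 0" by (auto simp: b_def)
    then have "{j. j \<le> m \<and> b j \<noteq> 0} \<subset> S"
      using j unfolding S_def by blast
    then have "card {j. j \<le> m \<and> b j \<noteq> 0} < card {j. j \<le> m \<and> a j \<noteq> 0}"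
      using fin unfolding S_def by (rule psubset_card_mono[rotated])
    then have "b j0 = 0" using rel j by (intro less.hyps) (auto simp: S_def)
    moreover have "Pc ^ (m - j0) = Pc ^ (j1 - j0) * Pc ^ (m - j1)"
      using j by (simp add: S_def flip: power_add)
    ultimately have "Pc ^ (m - j1) * (a j1 * subst_pow (a j0) * Pc ^ (j1 - j0))
        = Pc ^ (m - j1) * (subst_pow (a j1) * a j0)"
      by (simp add: b_def mult_ac)
    \<comment> \<open>So \<open>a j1 / a j0\<close> is a rational solution with exponent
      \<open>j1 - j0 > 0\<close>.\<close>
    then have "a j1 * subst_pow (a j0) * Pc ^ (j1 - j0) = subst_pow (a j1) * a j0"
      using Pc_nonzero by simp
    then have False by (rule no_rational_solution) (use j in \<open>auto simp: S_def\<close>)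
    then show ?thesis ..
  next
    case False
    show ?thesis
    proof (rule ccontr)
      assume nz: "a j \<noteq> 0"
      have "a k = 0" if "k \<le> m" "k \<noteq> j" for k
        using False nz that less.prems(2) by (auto simp: S_def) (metis linorder_neqE_nat)
      then have "(\<Sum>j\<le>m. fps_of_poly (a j) * Fc ^ j) = (\<Sum>k\<le>m. if k = j then fps_of_poly (a j) * Fc ^ j else 0)"
        by (intro sum.cong) auto
      then have "fps_of_poly (a j) * Fc ^ j = 0" using less.prems by simp
      then show False using nz Fc_nonzero by (simp add: fps_of_poly_eq_iff[of _ 0, simplified])
    qed
  qed
qed

end

section \<open>Specialization at powers of 1/b\<close>

lemma fps_conv_radius_ge_1:
  fixes E :: "'a::{banach, real_normed_div_algebra} fps"
  assumes "\<And>n. norm (E $ n) \<le> 1"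
  shows "fps_conv_radius E \<ge> 1"
  unfolding fps_conv_radius_def
proof (rule conv_radius_geI_ex')
  fix r :: real assume r: "0 < r" "ereal r < 1"
  show "summable (\<lambda>n. E $ n * of_real r ^ n)"
  proof (rule summable_comparison_test')
    show "summable (\<lambda>n. r ^ n)" using r by (intro summable_geometric) (simp add: one_ereal_def)
    show "norm (E $ n * of_real r ^ n) \<le> r ^ n" if "n \<ge> 0" for n
      using mult_right_mono[OF assms[of n], of "r ^ n"] r by (simp add: norm_mult norm_power)
  qed
qed

lemma eval_fps_sum:
  fixes E :: "'i \<Rightarrow> 'a::{banach, real_normed_div_algebra, comm_ring_1} fps"
  assumes "finite I" "\<And>i. i \<in> I \<Longrightarrow> norm z < fps_conv_radius (E i)"
  shows "norm z < fps_conv_radius (\<Sum>i\<in>I. E i) \<and> eval_fps (\<Sum>i\<in>I. E i) z = (\<Sum>i\<in>I. eval_fps (E i) z)"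
  using assms
proof (induction I rule: finite_induct)
  case (insert i I)
  then have IH: "norm z < fps_conv_radius (\<Sum>i\<in>I. E i)" "norm z < fps_conv_radius (E i)"
    "eval_fps (\<Sum>i\<in>I. E i) z = (\<Sum>i\<in>I. eval_fps (E i) z)" by auto
  then have "norm z < fps_conv_radius (E i + (\<Sum>i\<in>I. E i))"
    using fps_conv_radius_add[of "E i" "\<Sum>i\<in>I. E i"] by (meson less_le_trans min_less_iff_conj)
  then show ?case using insert IH by (simp add: eval_fps_add)
qed simp

text \<open>After division by \<open>z ^ subdegree E\<close> the series is continuous and nonzero at
  0. The lower bound matters as much as the upper one: it keeps the specialized forms away from
  0.\<close>

lemma eval_fps_leading_term:
  fixes E :: "complex fps"
  assumes rad: "fps_conv_radius E > 0" and nz: "E \<noteq> 0"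
  obtains c C \<epsilon> :: real where "c > 0" "C > 0" "\<epsilon> > 0"
    "\<And>z. z \<noteq> 0 \<Longrightarrow> norm z < \<epsilon> \<Longrightarrow> c * norm z ^ subdegree E \<le> norm (eval_fps E z)"
    "\<And>z. z \<noteq> 0 \<Longrightarrow> norm z < \<epsilon> \<Longrightarrow> norm (eval_fps E z) \<le> C * norm z ^ subdegree E"
proof -
  define s where "s = subdegree E"
  define G where "G = fps_shift s E"
  define g where "g = norm (E $ s)"
  have g: "g > 0" using nz by (simp add: g_def s_def)
  have "isCont (eval_fps G) 0"
    using continuous_eval_fps[of 0 G UNIV] rad by (simp add: G_def zero_ereal_def)
  then have "((\<lambda>z. norm (eval_fps G z)) \<longlongrightarrow> norm (eval_fps G 0)) (at 0)"
    by (intro tendsto_norm) (simp add: isCont_def)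
  moreover have "norm (eval_fps G 0) = g" by (simp add: eval_fps_at_0 G_def g_def)
  ultimately have lim: "((\<lambda>z. norm (eval_fps G z)) \<longlongrightarrow> g) (at 0)" by simp
  have "eventually (\<lambda>z. norm (eval_fps G z) > g / 2 \<and> norm (eval_fps G z) < 2 * g) (at 0)"
    using g by (intro eventually_conj order_tendstoD[OF lim]) auto
  then obtain \<delta> where \<delta>: "\<delta> > 0" and bd: "\<And>z. z \<noteq> 0 \<Longrightarrow> norm z < \<delta> \<Longrightarrow>
      norm (eval_fps G z) > g / 2 \<and> norm (eval_fps G z) < 2 * g"
    unfolding eventually_at by (auto simp: dist_norm)
  obtain r where r: "r > 0" "ereal r < fps_conv_radius E"
    using ereal_dense2[OF rad] by (metis ereal_less(2))
  have ev: "eval_fps E z = z ^ s * eval_fps G z" if "z \<noteq> 0" "norm z < r" for z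
    using eval_fps_shift[of s E z] that r unfolding G_def s_def
    by (simp add: order.strict_trans[of "ereal (norm z)" "ereal r"])
  show thesis
  proof (rule that[of "g / 2" "2 * g" "min \<delta> r"])
    fix z :: complex assume z: "z \<noteq> 0" "norm z < min \<delta> r"
    have e: "norm (eval_fps E z) = norm (eval_fps G z) * norm z ^ s"
      using z by (simp add: ev norm_mult norm_power)
    show "g / 2 * norm z ^ subdegree E \<le> norm (eval_fps E z)"
      unfolding e s_def[symmetric] using bd[of z] z by (intro mult_right_mono) auto
    show "norm (eval_fps E z) \<le> 2 * g * norm z ^ subdegree E"
      unfolding e s_def[symmetric] using bd[of z] z by (intro mult_right_mono) auto
  qed (use g \<delta> r in auto)
qed

section \<open>Integer polynomials at reciprocals of integers\<close>

abbreviation cpoly :: "int poly \<Rightarrow> complex poly" where "cpoly \<equiv> map_poly of_int"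

lemma cpoly_mult: "cpoly (A * B) = cpoly A * cpoly B"
  by (intro poly_eqI) (simp add: coeff_map_poly coeff_mult)

lemma cpoly_add: "cpoly (A + B) = cpoly A + cpoly B"
  by (intro poly_eqI) (simp add: coeff_map_poly)

lemma poly_cpoly_pcompose_monom: "poly (cpoly (pcompose A (monom 1 n))) z = poly (cpoly A) (z ^ n)"
  by (induction A)
    (simp_all add: pcompose_pCons cpoly_add cpoly_mult map_poly_pCons map_poly_monom poly_monom)

text \<open>The integer \<open>W ^ n * A(1 / W)\<close>, when \<open>n\<close> is at least the
  degree of \<open>A\<close> and \<open>W\<close> is nonzero.\<close>

definition homogenized :: "int poly \<Rightarrow> nat \<Rightarrow> int \<Rightarrow> int" where
  "homogenized A n W = (\<Sum>i\<le>n. coeff A i * W ^ (n - i))"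

lemma of_int_homogenized:
  assumes "degree A \<le> n" "W \<noteq> 0"
  shows "(of_int (homogenized A n W) :: complex) = of_int W ^ n * poly (cpoly A) (1 / of_int W)"
proof -
  have d: "degree (cpoly A) \<le> n"
    using assms(1) map_poly_degree_leq[of of_int A] by (rule order.trans[rotated])
  have "poly (cpoly A) (1 / of_int W) = (\<Sum>i\<le>n. of_int (coeff A i) * (1 / of_int W) ^ i)"
    unfolding poly_altdef by (rule sum.mono_neutral_cong_left)
      (use d in \<open>auto simp: coeff_map_poly degree_map_poly intro: le_degree\<close>)
  then have "of_int W ^ n * poly (cpoly A) (1 / of_int W)
      = (\<Sum>i\<le>n. of_int (coeff A i) * (of_int W ^ n * (1 / of_int W) ^ i))"
    by (simp add: sum_distrib_left mult_ac)
  also have "\<dots> = (\<Sum>i\<le>n. of_int (coeff A i) * of_int W ^ (n - i))"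
    by (intro sum.cong refl) (use assms(2) in \<open>simp add: power_diff power_one_over field_simps\<close>)
  finally show ?thesis by (simp add: homogenized_def)
qed

lemma abs_homogenized_le:
  assumes "W \<ge> 1"
  shows "\<bar>homogenized A n W\<bar> \<le> (\<Sum>i\<le>n. \<bar>coeff A i\<bar>) * W ^ n"
proof -
  have "\<bar>homogenized A n W\<bar> \<le> (\<Sum>i\<le>n. \<bar>coeff A i * W ^ (n - i)\<bar>)"
    unfolding homogenized_def by (rule sum_abs)
  also have "\<dots> \<le> (\<Sum>i\<le>n. \<bar>coeff A i\<bar> * W ^ n)"
    using assms by (intro sum_mono) (auto simp: abs_mult intro!: mult_left_mono power_increasing)
  finally show ?thesis by (simp add: sum_distrib_right)
qed

context sign_mahler
begin

lemma norm_Fc_nth: "norm (Fc $ n) = 1"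
  using f_sign[of n] by auto

lemma Fc_conv_radius: "fps_conv_radius Fc \<ge> 1"
  by (rule fps_conv_radius_ge_1) (simp only: norm_Fc_nth)

lemma less_conv_radius: "norm z < 1 \<Longrightarrow> ereal (norm z) < fps_conv_radius Fc"
  using Fc_conv_radius by (metis ereal_less(3) less_ereal.simps(1) one_ereal_def order_less_le_trans)

lemma eval_Fc_functional:
  assumes z: "norm z < 1"
  shows "eval_fps Fc z = poly Pc z * eval_fps Fc (z ^ p)"
proof -
  let ?G = "Fc oo fps_X ^ p"
  have p0: "p > 0" using p_ge by simp
  have G: "?G $ n = (if p dvd n then of_int (f (n div p)) else 0)" for n
    by (simp only: fps_nth_compose_X_power Fc_nth)
  have "fps_conv_radius ?G \<ge> 1"
  proof (rule fps_conv_radius_ge_1)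
    show "norm (?G $ n) \<le> 1" for n
      using norm_Fc_nth[of "n div p"] by (simp add: G del: of_int_eq_iff)
  qed
  then have rad: "ereal (norm z) < fps_conv_radius ?G"
    using z by (metis less_ereal.simps(1) one_ereal_def order_less_le_trans)
  have zp: "norm (z ^ p) < 1" using z p0 by (simp add: norm_power power_less_one_iff)
  have "(\<lambda>n. Fc $ n * (z ^ p) ^ n) sums eval_fps Fc (z ^ p)"
    by (rule sums_eval_fps[OF less_conv_radius[OF zp]])
  moreover have "Fc $ n * (z ^ p) ^ n = ?G $ (p * n) * z ^ (p * n)" for n
    using p0 by (simp add: G power_mult)
  ultimately have "(\<lambda>n. ?G $ (p * n) * z ^ (p * n)) sums eval_fps Fc (z ^ p)" by simp
  then have "(\<lambda>n. ?G $ n * z ^ n) sums eval_fps Fc (z ^ p)"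
    by (subst (asm) sums_mono_reindex) (use p0 in \<open>auto simp: strict_mono_def G\<close>)
  then have e: "eval_fps ?G z = eval_fps Fc (z ^ p)"
    unfolding eval_fps_def by (rule sums_unique[symmetric])
  have "eval_fps Fc z = eval_fps (fps_of_poly Pc * ?G) z"
    using Fc_functional by simp
  also have "\<dots> = poly Pc z * eval_fps Fc (z ^ p)"
    using rad by (subst eval_fps_mult) (simp_all add: e)
  finally show ?thesis .
qed

lemma eval_Fc_iterate:
  assumes z: "norm z < 1"
  shows "eval_fps Fc z = poly (cpoly (poly_prod p P k)) z * eval_fps Fc (z ^ (p ^ k))"
proof (induction k)
  case 0
  then show ?case by (simp add: poly_prod_def)
next
  case (Suc k)
  have "norm (z ^ (p ^ k)) < 1" using z p_ge by (simp add: norm_power power_less_one_iff)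
  then have "eval_fps Fc (z ^ (p ^ k)) = poly Pc (z ^ (p ^ k)) * eval_fps Fc (z ^ (p ^ Suc k))"
    by (subst eval_Fc_functional) (simp_all add: power_mult[symmetric] mult.commute)
  moreover have "poly (cpoly (poly_prod p P (Suc k))) z
      = poly (cpoly (poly_prod p P k)) z * poly Pc (z ^ (p ^ k))"
    by (simp add: poly_prod_def cpoly_mult poly_cpoly_pcompose_monom Pc_def)
  ultimately show ?case using Suc by simp
qed

lemma degree_poly_prod: "degree (poly_prod p P k) < p ^ k"
proof (induction k)
  case 0
  then show ?case by (simp add: poly_prod_def)
next
  case (Suc k)
  have "degree (poly_prod p P (Suc k)) \<le> degree P + degree (pcompose (poly_prod p P k) (monom 1 p))"
    unfolding poly_prod_Suc by (rule degree_mult_le)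
  also have "\<dots> \<le> (p - 1) + degree (poly_prod p P k) * p"
    by (simp add: degree_P degree_pcompose degree_monom_eq)
  also have "\<dots> < p * (degree (poly_prod p P k) + 1)" using p_ge by (simp add: algebra_simps)
  also have "\<dots> \<le> p * p ^ k" using Suc by (intro mult_le_mono2) simp
  finally show ?case by simp
qed

text \<open>Rational root test: modulo \<open>c\<close> the integer
  \<open>c ^ (p - 1) * P(1 / c)\<close> is the leading coefficient of \<open>P\<close>, which is a
  unit.\<close>

lemma Pc_inverse_nonzero:
  assumes "c \<ge> 2"
  shows "poly Pc (1 / of_int c) \<noteq> 0"
proof
  assume "poly Pc (1 / of_int c) = 0"
  then have "(of_int (homogenized P (p - 1) c) :: complex) = 0"
    using assms by (subst of_int_homogenized) (simp_all add: degree_P Pc_def)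
  then have h: "homogenized P (p - 1) c = 0" by (simp only: of_int_eq_0_iff)
  obtain q where q: "p - 1 = Suc q" using p_ge by (cases "p - 1") auto
  have "homogenized P (p - 1) c = (\<Sum>i\<le>q. coeff P i * c ^ (Suc q - i)) + coeff P (p - 1)"
    unfolding homogenized_def q by simp
  moreover have "c dvd (\<Sum>i\<le>q. coeff P i * c ^ (Suc q - i))"
    by (intro dvd_sum dvd_mult dvd_power) auto
  ultimately have "c dvd coeff P (p - 1)" using h by (metis dvd_0_right dvd_add_right_iff)
  then have "c dvd 1" using coeff_sign[of "p - 1"] p_ge by auto
  then show False using assms by auto
qed

lemma poly_prod_inverse_nonzero:
  assumes "b \<ge> 2"
  shows "poly (cpoly (poly_prod p P k)) (1 / of_int b) \<noteq> 0"
proof (induction k)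
  case 0
  then show ?case by (simp add: poly_prod_def)
next
  case (Suc k)
  have "b \<le> b ^ (p ^ k)" using assms p_ge by (intro self_le_power) auto
  then have "poly Pc (1 / of_int (b ^ (p ^ k))) \<noteq> 0" using assms by (intro Pc_inverse_nonzero) simp
  moreover have "poly (cpoly (poly_prod p P (Suc k))) (1 / of_int b)
      = poly (cpoly (poly_prod p P k)) (1 / of_int b) * poly Pc ((1 / of_int b) ^ (p ^ k))"
    by (simp add: poly_prod_def cpoly_mult poly_cpoly_pcompose_monom Pc_def)
  ultimately show ?case using Suc by (simp add: power_one_over)
qed

text \<open>With the exponent \<open>p ^ k\<close>, which exceeds the degree of the product, the
  iterated functional equation becomes \<open>W * F(1 / b) = R * F(1 / W)\<close> for the integers
  \<open>W = b ^ (p ^ k)\<close> and \<open>R = specialized_prod b k\<close>.\<close>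

definition specialized_prod :: "int \<Rightarrow> nat \<Rightarrow> int" where
  "specialized_prod b k = homogenized (poly_prod p P k) (p ^ k) b"

lemma of_int_specialized_prod:
  assumes "b \<ge> 2"
  shows "(of_int (specialized_prod b k) :: complex)
    = of_int (b ^ (p ^ k)) * poly (cpoly (poly_prod p P k)) (1 / of_int b)"
  unfolding specialized_prod_def using assms degree_poly_prod[of k]
  by (subst of_int_homogenized) auto

lemma eval_Fc_inverse:
  assumes "b \<ge> 2"
  shows "of_int (b ^ (p ^ k)) * eval_fps Fc (1 / of_int b)
    = of_int (specialized_prod b k) * eval_fps Fc (1 / of_int (b ^ (p ^ k)))"
proof -
  have "norm (1 / of_int b :: complex) < 1" using assms by (simp add: norm_divide)
  from eval_Fc_iterate[OF this, of k] show ?thesis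
    by (simp only: of_int_specialized_prod[OF assms] power_one_over of_int_power mult.assoc)
qed

lemma less_base_power:
  fixes b :: int
  assumes "b \<ge> 2"
  shows "int k < b ^ (p ^ k)"
proof -
  have "int k < int (p ^ k)" by (simp only: of_nat_less_iff less_power_self)
  also have "int (p ^ k) < int (2 ^ (p ^ k))" by (simp only: of_nat_less_iff less_exp)
  also have "int (2 ^ (p ^ k)) \<le> b ^ (p ^ k)" using assms by (simp add: power_mono)
  finally show ?thesis .
qed

lemma eventually_inverse_small:
  fixes b :: int
  assumes "b \<ge> 2" "\<epsilon> > 0"
  obtains k0 where "\<And>k. k \<ge> k0 \<Longrightarrow> norm (1 / of_int (b ^ (p ^ k)) :: complex) < \<epsilon>"
proof -
  obtain k0 where k0: "1 / \<epsilon> < real k0" using reals_Archimedean2 by blast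
  show thesis
  proof (rule that[of k0])
    fix k assume "k \<ge> k0"
    then have "real k0 < real_of_int (b ^ (p ^ k))"
      using less_base_power[OF assms(1), of k] by linarith
    with k0 have "1 / \<epsilon> < real_of_int (b ^ (p ^ k))" by linarith
    moreover from this assms have "real_of_int (b ^ (p ^ k)) > 0"
      by (meson divide_pos_pos less_trans zero_less_one)
    ultimately have "1 / real_of_int (b ^ (p ^ k)) < \<epsilon>"
      using assms(2) by (simp add: field_simps)
    then show "norm (1 / of_int (b ^ (p ^ k)) :: complex) < \<epsilon>"
      using assms(1) by (simp add: norm_divide norm_power)
  qed
qed

text \<open>In \<open>W * F(1 / b) = R * F(1 / W)\<close> the value \<open>F(1 / W)\<close> is
  bounded and bounded away from 0 for large \<open>k\<close>, so \<open>R\<close> has the order of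
  \<open>W\<close> once \<open>F(1 / b)\<close> is known to be nonzero. This is seen at
  \<open>k0\<close>, where neither factor on the right vanishes.\<close>

lemma specialized_prod_bounds:
  assumes b: "b \<ge> 2"
  obtains c C :: real and k0 where "c > 0" "C > 0"
    "\<And>k. k \<ge> k0 \<Longrightarrow> c * of_int (b ^ (p ^ k)) \<le> \<bar>real_of_int (specialized_prod b k)\<bar>"
    "\<And>k. k \<ge> k0 \<Longrightarrow> \<bar>real_of_int (specialized_prod b k)\<bar> \<le> C * of_int (b ^ (p ^ k))"
proof -
  define \<xi> where "\<xi> = eval_fps Fc (1 / of_int b)"
  have "fps_conv_radius Fc > 0" using less_conv_radius[of 0] by (simp add: zero_ereal_def)
  then obtain c C \<epsilon> :: real where cC: "c > 0" "C > 0" "\<epsilon> > 0"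
    and bd: "\<And>z. z \<noteq> 0 \<Longrightarrow> norm z < \<epsilon> \<Longrightarrow> c * norm z ^ subdegree Fc \<le> norm (eval_fps Fc z)"
    "\<And>z. z \<noteq> 0 \<Longrightarrow> norm z < \<epsilon> \<Longrightarrow> norm (eval_fps Fc z) \<le> C * norm z ^ subdegree Fc"
    using eval_fps_leading_term[OF _ Fc_nonzero] by metis
  have sub: "subdegree Fc = 0" by (intro subdegree_eq_0) simp
  obtain k0 where k0: "\<And>k. k \<ge> k0 \<Longrightarrow> norm (1 / of_int (b ^ (p ^ k)) :: complex) < \<epsilon>"
    using eventually_inverse_small[OF b cC(3)] by blast
  define e where "e = (\<lambda>k. norm (eval_fps Fc (1 / of_int (b ^ (p ^ k)))))"
  have e: "c \<le> e k" "e k \<le> C" if "k \<ge> k0" for k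
  proof -
    have nz: "(1 / of_int (b ^ (p ^ k)) :: complex) \<noteq> 0" using b by simp
    show "c \<le> e k" "e k \<le> C"
      using bd[OF nz k0[OF that]] by (simp_all only: sub power_0 mult_1_right e_def)
  qed
  have rel: "of_int (b ^ (p ^ k)) * norm \<xi> = \<bar>real_of_int (specialized_prod b k)\<bar> * e k" for k
    using arg_cong[OF eval_Fc_inverse[OF b, of k], of norm] b
    by (simp add: norm_mult norm_power e_def \<xi>_def)
  have "specialized_prod b k0 \<noteq> 0"
  proof
    assume "specialized_prod b k0 = 0"
    then show False
      using of_int_specialized_prod[OF b, of k0] poly_prod_inverse_nonzero[OF b, of k0] b by simp
  qed
  then have "norm \<xi> \<noteq> 0" using rel[of k0] e[of k0] cC by auto
  then have \<xi>: "norm \<xi> > 0" by simp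
  show thesis
  proof (rule that[of "norm \<xi> / C" "norm \<xi> / c" k0])
    fix k assume k: "k \<ge> k0"
    define R where "R = \<bar>real_of_int (specialized_prod b k)\<bar>"
    have "R * e k \<le> R * C" "R * c \<le> R * e k" using e[OF k] by (auto simp: R_def intro!: mult_left_mono)
    then show "norm \<xi> / C * of_int (b ^ (p ^ k)) \<le> \<bar>real_of_int (specialized_prod b k)\<bar>"
      "\<bar>real_of_int (specialized_prod b k)\<bar> \<le> norm \<xi> / c * of_int (b ^ (p ^ k))"
      using rel[of k] cC unfolding R_def[symmetric] by (simp_all add: field_simps)
  qed (use \<xi> cC in auto)
qed

lemma eval_relation:
  assumes z: "norm z < 1" and E: "E = (\<Sum>j\<le>m. fps_of_poly (A j) * Fc ^ j)"
  shows "ereal (norm z) < fps_conv_radius E"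
    and "eval_fps E z = (\<Sum>j\<le>m. poly (A j) z * eval_fps Fc z ^ j)"
proof -
  have F: "ereal (norm z) < fps_conv_radius (Fc ^ j)" for j
    using less_conv_radius[OF z] fps_conv_radius_power[of Fc j] by (rule less_le_trans)
  have t: "ereal (norm z) < fps_conv_radius (fps_of_poly (A j) * Fc ^ j)" for j
    using F[of j] fps_conv_radius_mult[of "fps_of_poly (A j)" "Fc ^ j"] by (simp add: less_le_trans)
  show "ereal (norm z) < fps_conv_radius E"
    unfolding E using eval_fps_sum[of "{..m}" z "\<lambda>j. fps_of_poly (A j) * Fc ^ j"] t by blast
  have "eval_fps E z = (\<Sum>j\<le>m. eval_fps (fps_of_poly (A j) * Fc ^ j) z)"
    unfolding E using eval_fps_sum[of "{..m}" z "\<lambda>j. fps_of_poly (A j) * Fc ^ j"] t by blast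
  also have "\<dots> = (\<Sum>j\<le>m. poly (A j) z * eval_fps Fc z ^ j)"
    using F less_conv_radius[OF z] by (intro sum.cong refl) (simp add: eval_fps_mult eval_fps_power)
  finally show "eval_fps E z = (\<Sum>j\<le>m. poly (A j) z * eval_fps Fc z ^ j)" .
qed

text \<open>A relation evaluated at \<open>b\<^bsup>-p^k\<^esup>\<close> becomes, after clearing denominators, an integer polynomial in the value
  at \<open>1 / b\<close>, whose size is governed by the order of vanishing at 0.\<close>

lemma specialization:
  assumes b: "b \<ge> 2" and deg: "\<And>j. j \<le> m \<Longrightarrow> degree (A j) \<le> N"
    and E: "E = (\<Sum>j\<le>m. fps_of_poly (cpoly (A j)) * Fc ^ j)" and E0: "E \<noteq> 0"
  shows "\<exists>c C :: real. \<exists>k0. c > 0 \<and> C > 0 \<and> (\<forall>k\<ge>k0. \<exists>q::nat \<Rightarrow> int.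
      (\<forall>j\<le>m. \<bar>real_of_int (q j)\<bar> \<le> C * of_int (b ^ (p ^ k)) ^ (N + m)) \<and>
      c * of_int (b ^ (p ^ k)) ^ (N + m)
        \<le> norm (\<Sum>j\<le>m. of_int (q j) * eval_fps Fc (1 / of_int b) ^ j) * of_int (b ^ (p ^ k)) ^ subdegree E \<and>
      norm (\<Sum>j\<le>m. of_int (q j) * eval_fps Fc (1 / of_int b) ^ j) * of_int (b ^ (p ^ k)) ^ subdegree E
        \<le> C * of_int (b ^ (p ^ k)) ^ (N + m))"
proof -
  define s where "s = subdegree E"
  define \<xi> where "\<xi> = eval_fps Fc (1 / of_int b)"
  have "fps_conv_radius E > 0" using eval_relation(1)[OF _ E, of 0] by (simp add: zero_ereal_def)
  then obtain c2 C2 \<epsilon> :: real where C2: "c2 > 0" "C2 > 0" "\<epsilon> > 0"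
    and bdE: "\<And>z. z \<noteq> 0 \<Longrightarrow> norm z < \<epsilon> \<Longrightarrow> c2 * norm z ^ s \<le> norm (eval_fps E z)"
    "\<And>z. z \<noteq> 0 \<Longrightarrow> norm z < \<epsilon> \<Longrightarrow> norm (eval_fps E z) \<le> C2 * norm z ^ s"
    using eval_fps_leading_term[OF _ E0] unfolding s_def by metis
  obtain k2 where k2: "\<And>k. k \<ge> k2 \<Longrightarrow> norm (1 / of_int (b ^ (p ^ k)) :: complex) < \<epsilon>"
    using eventually_inverse_small[OF b C2(3)] by blast
  obtain c1 C1 :: real and k1 where C1: "c1 > 0" "C1 > 0"
    and bdR: "\<And>k. k \<ge> k1 \<Longrightarrow> c1 * of_int (b ^ (p ^ k)) \<le> \<bar>real_of_int (specialized_prod b k)\<bar>"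
    "\<And>k. k \<ge> k1 \<Longrightarrow> \<bar>real_of_int (specialized_prod b k)\<bar> \<le> C1 * of_int (b ^ (p ^ k))"
    using specialized_prod_bounds[OF b] by metis
  define H where "H = (\<Sum>j\<le>m. \<Sum>i\<le>N. real_of_int \<bar>coeff (A j) i\<bar>)"
  have H: "H \<ge> 0" unfolding H_def by (intro sum_nonneg) auto
  \<comment> \<open>The maximum with 1 lets \<open>M ^ (m - j)\<close> be bounded by
    \<open>M ^ m\<close> for all \<open>j\<close> at once.\<close>
  define M where "M = max 1 C1"
  show ?thesis
  proof (rule exI[of _ "c1 ^ m * c2"], rule exI[of _ "C1 ^ m * C2 + H * M ^ m"],
      rule exI[of _ "max k1 k2"], intro conjI allI impI)
    show "c1 ^ m * c2 > 0" using C1 C2 by simp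
    have "H * M ^ m \<ge> 0" using H by (simp add: M_def)
    then show "C1 ^ m * C2 + H * M ^ m > 0" using C1 C2 by (simp add: add_pos_nonneg)
    fix k assume "k \<ge> max k1 k2"
    then have k: "k \<ge> k1" "k \<ge> k2" by auto
    define W where "W = b ^ (p ^ k)"
    define w where "w = real_of_int W"
    define R where "R = specialized_prod b k"
    define z where "z = (1 / of_int W :: complex)"
    have W1: "W \<ge> 1" using less_base_power[OF b, of k] by (simp add: W_def)
    then have w1: "w \<ge> 1" by (simp add: w_def)
    have z0: "z \<noteq> 0" using W1 by (simp add: z_def)
    have nz: "norm z = 1 / w" using W1 by (simp add: z_def w_def norm_divide)
    have z1: "norm z < 1"
    proof -
      have "b ^ 1 \<le> W" unfolding W_def using b p_ge by (intro power_increasing) auto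
      then show ?thesis using b by (simp add: nz w_def)
    qed
    have FR: "of_int R * eval_fps Fc z = of_int W * \<xi>"
      using eval_Fc_inverse[OF b, of k] by (simp only: R_def W_def z_def \<xi>_def)
    \<comment> \<open>Multiplying \<open>E(1 / W)\<close> by \<open>W ^ N * R ^ m\<close> clears
      denominators: \<open>W ^ N\<close> makes the coefficient an integer, and \<open>j\<close> of
      the factors \<open>R\<close> turn \<open>F(1 / W) ^ j\<close> into
      \<open>(W * \<xi>) ^ j\<close>.\<close>
    define q where "q = (\<lambda>j. homogenized (A j) N W * R ^ (m - j) * W ^ j)"
    have val: "(\<Sum>j\<le>m. of_int (q j) * \<xi> ^ j) = of_int W ^ N * of_int R ^ m * eval_fps E z"
      unfolding eval_relation(2)[OF z1 E] sum_distrib_left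
    proof (intro sum.cong refl)
      fix j assume j: "j \<in> {..m}"
      have "of_int (q j) * \<xi> ^ j
          = of_int W ^ N * poly (cpoly (A j)) z * of_int R ^ (m - j) * (of_int W * \<xi>) ^ j"
        using deg[of j] j W1 by (simp add: q_def z_def of_int_homogenized power_mult_distrib)
      also have "\<dots> = of_int W ^ N * poly (cpoly (A j)) z * (of_int R ^ (m - j) * of_int R ^ j)
          * eval_fps Fc z ^ j"
        unfolding FR[symmetric] by (simp add: power_mult_distrib)
      also have "of_int R ^ (m - j) * of_int R ^ j = (of_int R ^ m :: complex)"
        using j by (simp flip: power_add)
      finally show "of_int (q j) * \<xi> ^ j
          = of_int W ^ N * of_int R ^ m * (poly (cpoly (A j)) z * eval_fps Fc z ^ j)"
        by (simp add: mult_ac)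
    qed
    have R: "c1 * w \<le> \<bar>real_of_int R\<bar>" "\<bar>real_of_int R\<bar> \<le> C1 * w"
      using bdR[OF k(1)] by (simp_all only: R_def w_def W_def)
    have nrm: "norm (\<Sum>j\<le>m. of_int (q j) * \<xi> ^ j) * w ^ s
        = w ^ N * \<bar>real_of_int R\<bar> ^ m * (norm (eval_fps E z) * w ^ s)"
      unfolding val using W1 by (simp add: norm_mult norm_power w_def)
    have "norm z < \<epsilon>" using k2[OF k(2)] by (simp only: z_def W_def)
    then have "c2 * (1 / w) ^ s \<le> norm (eval_fps E z)" "norm (eval_fps E z) \<le> C2 * (1 / w) ^ s"
      using bdE[OF z0] by (simp_all add: nz)
    then have Ez: "c2 \<le> norm (eval_fps E z) * w ^ s" "norm (eval_fps E z) * w ^ s \<le> C2"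
      using w1 by (simp_all add: power_one_over field_simps)
    have lower: "c1 ^ m * c2 * w ^ (N + m) \<le> norm (\<Sum>j\<le>m. of_int (q j) * \<xi> ^ j) * w ^ s"
    proof -
      have "w ^ N * (c1 * w) ^ m * c2 \<le> w ^ N * \<bar>real_of_int R\<bar> ^ m * (norm (eval_fps E z) * w ^ s)"
        using R Ez w1 C1 C2 by (intro mult_mono power_mono order_refl) auto
      then show ?thesis unfolding nrm by (simp add: power_mult_distrib power_add mult_ac)
    qed
    have upper: "norm (\<Sum>j\<le>m. of_int (q j) * \<xi> ^ j) * w ^ s \<le> C1 ^ m * C2 * w ^ (N + m)"
    proof -
      have "w ^ N * \<bar>real_of_int R\<bar> ^ m * (norm (eval_fps E z) * w ^ s) \<le> w ^ N * (C1 * w) ^ m * C2"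
        using R Ez w1 C1 C2 by (intro mult_mono power_mono order_refl) auto
      then show ?thesis unfolding nrm by (simp add: power_mult_distrib power_add mult_ac)
    qed
    have qb: "\<bar>real_of_int (q j)\<bar> \<le> H * M ^ m * w ^ (N + m)" if j: "j \<le> m" for j
    proof -
      have "real_of_int \<bar>homogenized (A j) N W\<bar> \<le> of_int ((\<Sum>i\<le>N. \<bar>coeff (A j) i\<bar>) * W ^ N)"
        using abs_homogenized_le[OF W1, of "A j" N] by (simp only: of_int_le_iff)
      also have "\<dots> = (\<Sum>i\<le>N. real_of_int \<bar>coeff (A j) i\<bar>) * w ^ N" by (simp add: w_def)
      also have "(\<Sum>i\<le>N. real_of_int \<bar>coeff (A j) i\<bar>) \<le> H"
        unfolding H_def using j by (intro member_le_sum sum_nonneg) auto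
      finally have h: "\<bar>real_of_int (homogenized (A j) N W)\<bar> \<le> H * w ^ N"
        using w1 by (simp add: mult_right_mono)
      have "\<bar>real_of_int R\<bar> ^ (m - j) \<le> (M * w) ^ (m - j)"
        using R(2) w1 by (intro power_mono order.trans[OF R(2)] mult_right_mono) (auto simp: M_def)
      also have "\<dots> \<le> M ^ m * w ^ (m - j)"
        unfolding power_mult_distrib using w1
        by (intro mult_right_mono power_increasing) (auto simp: M_def)
      finally have r: "\<bar>real_of_int R\<bar> ^ (m - j) \<le> M ^ m * w ^ (m - j)" .
      have "\<bar>real_of_int (q j)\<bar> = \<bar>real_of_int (homogenized (A j) N W)\<bar> * \<bar>real_of_int R\<bar> ^ (m - j) * w ^ j"
        using W1 by (simp add: q_def abs_mult power_abs w_def)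
      also have "\<dots> \<le> (H * w ^ N) * (M ^ m * w ^ (m - j)) * w ^ j"
        using h r w1 H by (intro mult_mono order_refl) (auto simp: M_def)
      also have "\<dots> = H * M ^ m * (w ^ N * (w ^ (m - j) * w ^ j))" by (simp add: mult_ac)
      also have "w ^ (m - j) * w ^ j = w ^ m" using j by (simp flip: power_add)
      finally show ?thesis by (simp add: power_add)
    qed
    have "C1 ^ m * C2 \<ge> 0" using C1 C2 by simp
    then have "H * M ^ m * w ^ (N + m) \<le> (C1 ^ m * C2 + H * M ^ m) * w ^ (N + m)"
      "C1 ^ m * C2 * w ^ (N + m) \<le> (C1 ^ m * C2 + H * M ^ m) * w ^ (N + m)"
      using \<open>H * M ^ m \<ge> 0\<close> w1 by (auto intro!: mult_right_mono)
    with qb lower upper show "\<exists>q::nat \<Rightarrow> int.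
      (\<forall>j\<le>m. \<bar>real_of_int (q j)\<bar> \<le> (C1 ^ m * C2 + H * M ^ m) * of_int (b ^ (p ^ k)) ^ (N + m)) \<and>
      c1 ^ m * c2 * of_int (b ^ (p ^ k)) ^ (N + m)
        \<le> norm (\<Sum>j\<le>m. of_int (q j) * eval_fps Fc (1 / of_int b) ^ j) * of_int (b ^ (p ^ k)) ^ subdegree E \<and>
      norm (\<Sum>j\<le>m. of_int (q j) * eval_fps Fc (1 / of_int b) ^ j) * of_int (b ^ (p ^ k)) ^ subdegree E
        \<le> (C1 ^ m * C2 + H * M ^ m) * of_int (b ^ (p ^ k)) ^ (N + m)"
      unfolding s_def[symmetric] \<xi>_def[symmetric] W_def[symmetric] w_def[symmetric]
      by (intro exI[of _ q]) (meson order_trans)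
  qed
qed

end

section \<open>A Liouville inequality\<close>

definition height_le :: "int poly \<Rightarrow> real \<Rightarrow> bool" where
  "height_le A H \<longleftrightarrow> (\<forall>i. \<bar>real_of_int (coeff A i)\<bar> \<le> H)"

lemma height_leD: "height_le A H \<Longrightarrow> \<bar>real_of_int (coeff A i)\<bar> \<le> H"
  by (simp add: height_le_def)

lemma height_le_mono: "height_le A H \<Longrightarrow> H \<le> H' \<Longrightarrow> height_le A H'"
  unfolding height_le_def by (meson order_trans)

lemma height_le_exists: obtains H where "H \<ge> 1" "height_le A H"
proof (rule that[of "1 + (\<Sum>i\<le>degree A. \<bar>real_of_int (coeff A i)\<bar>)"])
  show "1 + (\<Sum>i\<le>degree A. \<bar>real_of_int (coeff A i)\<bar>) \<ge> 1" by (simp add: sum_nonneg)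
  have "\<bar>real_of_int (coeff A i)\<bar> \<le> 1 + (\<Sum>i\<le>degree A. \<bar>real_of_int (coeff A i)\<bar>)" for i
  proof (cases "i \<le> degree A")
    case True
    then have "\<bar>real_of_int (coeff A i)\<bar> \<le> (\<Sum>i\<le>degree A. \<bar>real_of_int (coeff A i)\<bar>)"
      by (intro member_le_sum) auto
    then show ?thesis by simp
  qed (simp add: coeff_eq_0 sum_nonneg add_nonneg_nonneg)
  then show "height_le A (1 + (\<Sum>i\<le>degree A. \<bar>real_of_int (coeff A i)\<bar>))"
    by (simp add: height_le_def)
qed

text \<open>One step of pseudo-division: for \<open>degree B \<le> degree A\<close> the
  cross-multiplied leading terms cancel, with no division of coefficients.\<close>

definition reduce :: "int poly \<Rightarrow> int poly \<Rightarrow> int poly" where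
  "reduce A B = smult (lead_coeff B) A - smult (lead_coeff A) (monom 1 (degree A - degree B) * B)"

lemma coeff_reduce:
  "coeff (reduce A B) i = lead_coeff B * coeff A i
     - lead_coeff A * (if degree A - degree B \<le> i then coeff B (i - (degree A - degree B)) else 0)"
  by (simp add: reduce_def coeff_monom_mult)

lemma degree_reduce:
  assumes "degree B \<le> degree A" "degree A > 0"
  shows "degree (reduce A B) < degree A"
proof -
  have "degree (reduce A B) \<le> degree A - 1"
  proof (rule degree_le, intro allI impI)
    fix i assume "i > degree A - 1"
    then consider "i = degree A" | "i > degree A" using assms(2) by linarith
    then show "coeff (reduce A B) i = 0"
      using assms by cases (auto simp: coeff_reduce coeff_eq_0)
  qed
  then show ?thesis using assms by simp
qed

lemma height_reduce:
  assumes A: "height_le A H" and B: "height_le B H'"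
  shows "height_le (reduce A B) (2 * (H * H'))"
  unfolding height_le_def
proof
  fix i
  define c where "c = (if degree A - degree B \<le> i then coeff B (i - (degree A - degree B)) else 0)"
  have H: "H \<ge> 0" "H' \<ge> 0" using height_leD[OF A, of 0] height_leD[OF B, of 0] by auto
  have c: "\<bar>real_of_int c\<bar> \<le> H'" using height_leD[OF B] H by (auto simp: c_def)
  have "\<bar>real_of_int (lead_coeff B) * real_of_int (coeff A i)\<bar> \<le> H' * H"
    unfolding abs_mult using height_leD[OF A] height_leD[OF B] H by (intro mult_mono) auto
  moreover have "\<bar>real_of_int (lead_coeff A) * real_of_int c\<bar> \<le> H * H'"
    unfolding abs_mult using height_leD[OF A] c H by (intro mult_mono) auto
  ultimately show "\<bar>real_of_int (coeff (reduce A B) i)\<bar> \<le> 2 * (H * H')"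
    unfolding coeff_reduce c_def[symmetric] of_int_diff of_int_mult by (simp add: mult.commute)
qed

lemma cpoly_smult: "cpoly (smult c A) = smult (of_int c) (cpoly A)"
  by (intro poly_eqI) (simp add: coeff_map_poly)

lemma cpoly_diff: "cpoly (A - B) = cpoly A - cpoly B"
  by (intro poly_eqI) (simp add: coeff_map_poly)

lemma poly_reduce:
  "poly (cpoly (reduce A B)) \<alpha> = of_int (lead_coeff B) * poly (cpoly A) \<alpha>
     - of_int (lead_coeff A) * \<alpha> ^ (degree A - degree B) * poly (cpoly B) \<alpha>"
  by (simp add: reduce_def cpoly_diff cpoly_smult cpoly_mult map_poly_monom poly_monom)

text \<open>Up to scaling, so that coprimality over the rationals is expressed without leaving the integers.\<close>

definition no_common_factor :: "int poly \<Rightarrow> int poly \<Rightarrow> bool" where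
  "no_common_factor A B \<longleftrightarrow> (\<forall>D a b. a \<noteq> 0 \<longrightarrow> b \<noteq> 0 \<longrightarrow>
     D dvd smult a A \<longrightarrow> D dvd smult b B \<longrightarrow> degree D = 0)"

lemma no_common_factor_sym: "no_common_factor A B \<Longrightarrow> no_common_factor B A"
  unfolding no_common_factor_def by blast

text \<open>Up to a nonzero scalar, \<open>A\<close> is a combination of \<open>reduce A B\<close>
  and \<open>B\<close>, so common divisors are inherited.\<close>

lemma no_common_factor_reduce:
  assumes "no_common_factor A B" "B \<noteq> 0"
  shows "no_common_factor (reduce A B) B"
  unfolding no_common_factor_def
proof (intro allI impI)
  fix D a b assume ab: "a \<noteq> (0::int)" "b \<noteq> (0::int)"
    and D: "D dvd smult a (reduce A B)" "D dvd smult b B"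
  define C where "C = monom 1 (degree A - degree B) * smult (a * lead_coeff A) (smult b B)"
  have "smult (a * b * lead_coeff B) A = smult b (smult a (reduce A B)) + C"
    by (simp add: reduce_def C_def smult_diff_right mult_ac)
  moreover have "D dvd smult b (smult a (reduce A B))" using D(1) by (rule dvd_smult)
  moreover have "D dvd C" unfolding C_def by (intro dvd_mult dvd_smult D(2))
  ultimately have "D dvd smult (a * b * lead_coeff B) A" by simp
  moreover have "a * b * lead_coeff B \<noteq> 0" using ab assms(2) by simp
  ultimately show "degree D = 0"
    using assms(1) D(2) ab(2) unfolding no_common_factor_def by blast
qed

lemma norm_poly_constant_ge_1:
  assumes "degree A = 0" "A \<noteq> 0"
  shows "norm (poly (cpoly A) \<alpha>) \<ge> 1"
proof -
  obtain c where "A = [:c:]" using assms(1) by (rule degree_eq_zeroE)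
  with assms(2) show ?thesis by (simp add: map_poly_pCons)
qed

text \<open>One step of the Euclidean algorithm lowers the total degree and squares the height. The exponent
  \<open>K\<close> is therefore exponential in \<open>s\<close>, which is harmless as long as \<open>s\<close> depends on \<open>\<alpha>\<close> only.\<close>

lemma euclid_lower_bound:
  fixes \<alpha> :: complex
  shows "\<exists>C K. C \<ge> 1 \<and> (\<forall>A B H. degree A + degree B \<le> s \<longrightarrow> H \<ge> 1 \<longrightarrow> height_le A H \<longrightarrow> height_le B H
     \<longrightarrow> A \<noteq> 0 \<or> B \<noteq> 0 \<longrightarrow> no_common_factor A B
     \<longrightarrow> 1 \<le> C * H ^ K * max (norm (poly (cpoly A) \<alpha>)) (norm (poly (cpoly B) \<alpha>)))"
    (is "\<exists>C K. C \<ge> 1 \<and> (\<forall>A B H. ?P s C K A B H)")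
proof (induction s)
  have const: "1 \<le> C * H ^ K * max x y" if "C \<ge> 1" "H \<ge> 1" "x \<ge> 1" for C H x y :: real and K :: nat
  proof -
    have "1 * 1 * 1 \<le> C * H ^ K * max x y" using that by (intro mult_mono) auto
    then show ?thesis by simp
  qed
  have A0: "degree A = 0" if "no_common_factor A 0" for A
    using that unfolding no_common_factor_def by (metis dvd_0_right dvd_refl smult_0_right smult_1_left zero_neq_one)
  {
    case 0
    show ?case
    proof (rule exI[of _ 1], rule exI[of _ 0], intro conjI allI impI)
      fix A B :: "int poly" and H :: real
      assume "degree A + degree B \<le> 0" "A \<noteq> 0 \<or> B \<noteq> 0"
      then have "norm (poly (cpoly A) \<alpha>) \<ge> 1 \<or> norm (poly (cpoly B) \<alpha>) \<ge> 1"
        using norm_poly_constant_ge_1 by auto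
      then show "1 \<le> 1 * H ^ 0 * max (norm (poly (cpoly A) \<alpha>)) (norm (poly (cpoly B) \<alpha>))" by auto
    qed simp
  next
    case (Suc s)
    then obtain C K where C: "C \<ge> 1" and IH: "\<And>A B H. ?P s C K A B H" by blast
    define L where "L = max 1 (norm \<alpha>)"
    define C' where "C' = C * 2 ^ K * (2 * L ^ Suc s)"
    \<comment> \<open>\<open>2 * K\<close> stems from the height \<open>2 * (H * H)\<close> of the
      remainder, the additional 1 from the factor \<open>H\<close> in the bound for its value at
      \<open>\<alpha>\<close>.\<close>
    define K' where "K' = 2 * K + 1"
    have L: "L \<ge> 1" "norm \<alpha> \<le> L" by (auto simp: L_def)
    have C': "C' \<ge> 1"
    proof -
      have "1 * 1 * (1 * 1) \<le> C * 2 ^ K * (2 * L ^ Suc s)"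
        using C L by (intro mult_mono one_le_power) auto
      then show ?thesis by (simp add: C'_def)
    qed
    have main: "?P (Suc s) C' K' A B H" if BA: "degree B \<le> degree A" for A B H
    proof (intro impI)
      assume deg: "degree A + degree B \<le> Suc s" and H: "H \<ge> 1"
        and hA: "height_le A H" and hB: "height_le B H"
        and nz: "A \<noteq> 0 \<or> B \<noteq> 0" and ncf: "no_common_factor A B"
      define x y where "x = norm (poly (cpoly A) \<alpha>)" and "y = norm (poly (cpoly B) \<alpha>)"
      have "1 \<le> C' * H ^ K' * max x y"
      proof (cases "degree A = 0 \<or> B = 0")
        case True
        \<comment> \<open>If \<open>B = 0\<close>, coprimality makes \<open>A\<close> constant; a
          nonzero integer constant has absolute value at least 1.\<close>
        then have "degree A = 0 \<and> (A \<noteq> 0 \<or> degree B = 0 \<and> B \<noteq> 0)"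
          using A0 ncf nz BA by auto
        then have "x \<ge> 1 \<or> y \<ge> 1"
          using norm_poly_constant_ge_1 by (auto simp: x_def y_def)
        then show ?thesis using const[OF C' H, of x K' y] const[OF C' H, of y K' x]
          by (auto simp: max.commute)
      next
        case False
        then have B0: "B \<noteq> 0" and dA: "degree A > 0" by auto
        define x' where "x' = norm (poly (cpoly (reduce A B)) \<alpha>)"
        have "H * H \<ge> 1 * 1" "H * 1 \<le> H * H" using H by (intro mult_mono; simp)+
        then have H2: "2 * (H * H) \<ge> 1" "H \<le> 2 * (H * H)" using H by linarith+
        have IH': "1 \<le> C * (2 * (H * H)) ^ K * max x' y"
          unfolding x'_def y_def
          by (rule IH[rule_format, OF _ H2(1) height_reduce[OF hA hB] height_le_mono[OF hB H2(2)] _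
                no_common_factor_reduce[OF ncf B0]])
            (use degree_reduce[OF BA dA] deg B0 in auto)
        have "max x' y \<le> 2 * H * L ^ Suc s * max x y"
        proof (rule max.boundedI)
          have Ls: "L ^ Suc s \<ge> 1" using L by (intro one_le_power)
          have m: "max x y \<ge> 0" by (simp add: x_def le_max_iff_disj)
          have "x' \<le> \<bar>real_of_int (lead_coeff B)\<bar> * x
              + \<bar>real_of_int (lead_coeff A)\<bar> * norm \<alpha> ^ (degree A - degree B) * y"
            unfolding x'_def poly_reduce x_def y_def
            by (rule order.trans[OF norm_triangle_ineq4]) (simp add: norm_mult norm_power)
          also have "\<dots> \<le> H * L ^ Suc s * max x y + H * L ^ Suc s * max x y"
          proof (rule add_mono)
            have "\<bar>real_of_int (lead_coeff B)\<bar> * 1 * x \<le> H * L ^ Suc s * max x y"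
              using height_leD[OF hB] H Ls by (intro mult_mono) (auto simp: x_def)
            then show "\<bar>real_of_int (lead_coeff B)\<bar> * x \<le> H * L ^ Suc s * max x y" by simp
            have "norm \<alpha> ^ (degree A - degree B) \<le> L ^ (degree A - degree B)"
              using L by (intro power_mono) auto
            also have "\<dots> \<le> L ^ Suc s" using L deg by (intro power_increasing) auto
            finally show "\<bar>real_of_int (lead_coeff A)\<bar> * norm \<alpha> ^ (degree A - degree B) * y
                \<le> H * L ^ Suc s * max x y"
              using height_leD[OF hA] H Ls by (intro mult_mono) (auto simp: y_def)
          qed
          finally show "x' \<le> 2 * H * L ^ Suc s * max x y" by (simp add: mult_ac)
          have "1 * 1 * 1 \<le> 2 * H * L ^ Suc s" using H Ls by (intro mult_mono) auto
          then have "1 * max x y \<le> 2 * H * L ^ Suc s * max x y" using m by (intro mult_right_mono) auto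
          then show "y \<le> 2 * H * L ^ Suc s * max x y" by simp
        qed
        then have "C * (2 * (H * H)) ^ K * max x' y
            \<le> C * (2 * (H * H)) ^ K * (2 * H * L ^ Suc s * max x y)"
          using C H by (intro mult_left_mono) auto
        also have "\<dots> = C' * H ^ K' * max x y"
        proof -
          have HK: "H ^ K' = H ^ K * H ^ K * H" by (simp add: K'_def mult_2 power_add)
          show ?thesis unfolding C'_def HK power_mult_distrib by (simp only: mult_ac)
        qed
        finally show ?thesis using IH' by linarith
      qed
      then show "1 \<le> C' * H ^ K' * max (norm (poly (cpoly A) \<alpha>)) (norm (poly (cpoly B) \<alpha>))"
        by (simp only: x_def y_def)
    qed
    show ?case
    proof (intro exI[of _ C'] exI[of _ K'] conjI allI)
      show "?P (Suc s) C' K' A B H" for A B H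
      proof (cases "degree B \<le> degree A")
        case False
        then have "?P (Suc s) C' K' B A H" by (intro main) simp
        then show ?thesis using no_common_factor_sym by (auto simp: max.commute add.commute)
      qed (rule main)
    qed (rule C')
  }
qed

text \<open>Since \<open>M\<close> vanishes at \<open>\<alpha>\<close>, each pseudo-division by
  \<open>M\<close> only multiplies the value by the leading coefficient of \<open>M\<close>. The
  height stays linear in \<open>H\<close>, and \<open>n\<close> affects nothing but
  \<open>C\<close>; this is what frees the Liouville exponent from the degree of
  \<open>Q\<close>.\<close>

lemma reduce_modulo:
  assumes M: "degree M > 0" "height_le M h" "h \<ge> 1" and root: "poly (cpoly M) \<alpha> = 0"
  shows "\<exists>C\<ge>1. \<forall>Q H. degree Q \<le> n \<longrightarrow> height_le Q H \<longrightarrow>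
    (\<exists>r. degree r < degree M \<and> height_le r (C * H) \<and>
      (poly (cpoly Q) \<alpha> \<noteq> 0 \<longrightarrow> poly (cpoly r) \<alpha> \<noteq> 0) \<and>
      norm (poly (cpoly r) \<alpha>) \<le> C * norm (poly (cpoly Q) \<alpha>))"
proof (induction n)
  case 0
  show ?case
  proof (rule exI[of _ 1], intro conjI allI impI)
    fix Q :: "int poly" and H assume "degree Q \<le> 0" "height_le Q H"
    then show "\<exists>r. degree r < degree M \<and> height_le r (1 * H) \<and>
      (poly (cpoly Q) \<alpha> \<noteq> 0 \<longrightarrow> poly (cpoly r) \<alpha> \<noteq> 0) \<and>
      norm (poly (cpoly r) \<alpha>) \<le> 1 * norm (poly (cpoly Q) \<alpha>)"
      using M by (intro exI[of _ Q]) auto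
  qed simp
next
  case (Suc n)
  then obtain C where C: "C \<ge> 1" and IH: "\<And>Q H. degree Q \<le> n \<Longrightarrow> height_le Q H \<Longrightarrow>
    (\<exists>r. degree r < degree M \<and> height_le r (C * H) \<and>
      (poly (cpoly Q) \<alpha> \<noteq> 0 \<longrightarrow> poly (cpoly r) \<alpha> \<noteq> 0) \<and>
      norm (poly (cpoly r) \<alpha>) \<le> C * norm (poly (cpoly Q) \<alpha>))" by blast
  have "C * (2 * h) \<ge> 1 * 1" using C M by (intro mult_mono) auto
  then have C': "C * (2 * h) \<ge> 1" by simp
  show ?case
  proof (intro exI[of _ "C * (2 * h)"] conjI allI impI C')
    fix Q :: "int poly" and H assume Q: "degree Q \<le> Suc n" "height_le Q H"
    have H: "H \<ge> 0" using height_leD[OF Q(2), of 0] by simp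
    show "\<exists>r. degree r < degree M \<and> height_le r (C * (2 * h) * H) \<and>
      (poly (cpoly Q) \<alpha> \<noteq> 0 \<longrightarrow> poly (cpoly r) \<alpha> \<noteq> 0) \<and>
      norm (poly (cpoly r) \<alpha>) \<le> C * (2 * h) * norm (poly (cpoly Q) \<alpha>)"
    proof (cases "degree Q < degree M")
      case True
      then show ?thesis
        using height_le_mono[OF Q(2)] mult_right_mono[OF C' H]
          mult_right_mono[OF C', of "norm (poly (cpoly Q) \<alpha>)"]
        by (intro exI[of _ Q]) auto
    next
      case False
      define Q' where "Q' = reduce Q M"
      have "degree Q' < degree Q"
        unfolding Q'_def using False M by (intro degree_reduce) auto
      then have d: "degree Q' \<le> n" using Q by simp
      have h': "height_le Q' (2 * (H * h))"
        unfolding Q'_def by (rule height_reduce[OF Q(2) M(2)])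
      have v: "poly (cpoly Q') \<alpha> = of_int (lead_coeff M) * poly (cpoly Q) \<alpha>"
        unfolding Q'_def poly_reduce root by simp
      have lc: "lead_coeff M \<noteq> 0" using M by auto
      obtain r where r: "degree r < degree M" "height_le r (C * (2 * (H * h)))"
        "poly (cpoly Q') \<alpha> \<noteq> 0 \<longrightarrow> poly (cpoly r) \<alpha> \<noteq> 0"
        "norm (poly (cpoly r) \<alpha>) \<le> C * norm (poly (cpoly Q') \<alpha>)"
        using IH[OF d h'] by blast
      have "norm (poly (cpoly Q') \<alpha>) \<le> (2 * h) * norm (poly (cpoly Q) \<alpha>)"
        unfolding v norm_mult using height_leD[OF M(2), of "degree M"] M(3)
        by (intro mult_right_mono) auto
      then have "norm (poly (cpoly r) \<alpha>) \<le> C * ((2 * h) * norm (poly (cpoly Q) \<alpha>))"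
        using C by (intro order.trans[OF r(4)] mult_left_mono) auto
      then show ?thesis using r lc v by (intro exI[of _ r]) (auto simp: mult_ac)
    qed
  qed
qed

text \<open>\<open>K\<close> is fixed before the degree bound \<open>n\<close>: it comes from the
  Euclidean algorithm for \<open>M\<close> of minimal degree and a remainder of smaller degree,
  while \<open>n\<close> enters only through the reduction modulo \<open>M\<close>.\<close>

lemma liouville_lower_bound:
  assumes "M \<noteq> 0" "poly (cpoly M) \<alpha> = 0"
  obtains K where "\<forall>n. \<exists>C>0. \<forall>Q H. degree Q \<le> n \<longrightarrow> H \<ge> 1 \<longrightarrow> height_le Q H \<longrightarrow>
    poly (cpoly Q) \<alpha> \<noteq> 0 \<longrightarrow> 1 \<le> C * H ^ K * norm (poly (cpoly Q) \<alpha>)"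
proof -
  obtain M where M: "M \<noteq> 0" "poly (cpoly M) \<alpha> = 0"
    and minimal: "\<And>N. N \<noteq> 0 \<Longrightarrow> poly (cpoly N) \<alpha> = 0 \<Longrightarrow> degree M \<le> degree N"
    using ex_has_least_nat[of "\<lambda>M. M \<noteq> 0 \<and> poly (cpoly M) \<alpha> = 0" M degree] assms by blast
  have d: "degree M > 0" using norm_poly_constant_ge_1[of M \<alpha>] M by (cases "degree M") auto
  obtain h where h: "h \<ge> 1" "height_le M h" by (rule height_le_exists)
  obtain C0 K where C0: "C0 \<ge> 1" and euclid: "\<And>A B H. degree A + degree B \<le> 2 * degree M \<Longrightarrow> H \<ge> 1 \<Longrightarrow>
     height_le A H \<Longrightarrow> height_le B H \<Longrightarrow> A \<noteq> 0 \<or> B \<noteq> 0 \<Longrightarrow> no_common_factor A B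
     \<Longrightarrow> 1 \<le> C0 * H ^ K * max (norm (poly (cpoly A) \<alpha>)) (norm (poly (cpoly B) \<alpha>))"
    using euclid_lower_bound[of "2 * degree M" \<alpha>] by blast
  show thesis
  proof (rule that[of K], rule allI)
    fix n
    obtain C where C: "C \<ge> 1" and red: "\<And>Q H. degree Q \<le> n \<Longrightarrow> height_le Q H \<Longrightarrow>
      (\<exists>r. degree r < degree M \<and> height_le r (C * H) \<and>
      (poly (cpoly Q) \<alpha> \<noteq> 0 \<longrightarrow> poly (cpoly r) \<alpha> \<noteq> 0) \<and>
      norm (poly (cpoly r) \<alpha>) \<le> C * norm (poly (cpoly Q) \<alpha>))"
      using reduce_modulo[OF d h(2,1) M(2)] by metis
    show "\<exists>C>0. \<forall>Q H. degree Q \<le> n \<longrightarrow> H \<ge> 1 \<longrightarrow> height_le Q H \<longrightarrow>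
      poly (cpoly Q) \<alpha> \<noteq> 0 \<longrightarrow> 1 \<le> C * H ^ K * norm (poly (cpoly Q) \<alpha>)"
    proof (intro exI[of _ "C0 * (C * h) ^ K * C"] conjI allI impI)
      show "C0 * (C * h) ^ K * C > 0" using C0 C h by simp
      fix Q :: "int poly" and H :: real
      assume Q: "degree Q \<le> n" "H \<ge> 1" "height_le Q H" "poly (cpoly Q) \<alpha> \<noteq> 0"
      obtain r where r: "degree r < degree M" "height_le r (C * H)" "poly (cpoly r) \<alpha> \<noteq> 0"
        "norm (poly (cpoly r) \<alpha>) \<le> C * norm (poly (cpoly Q) \<alpha>)"
        using red[OF Q(1,3)] Q(4) by blast
      have "C * H * 1 \<le> C * H * h" "1 * 1 * h \<le> C * H * h" "1 * 1 * 1 \<le> C * H * h"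
        using C Q h by (intro mult_mono; simp)+
      then have bounds: "C * H \<le> C * H * h" "h \<le> C * H * h" "1 \<le> C * H * h" by simp_all
      \<comment> \<open>A common factor \<open>D\<close> does not vanish at \<open>\<alpha>\<close>
        because \<open>r\<close> does not. Its cofactor in \<open>M\<close> therefore does, and by
        minimality has full degree.\<close>
      have "no_common_factor M r"
        unfolding no_common_factor_def
      proof (intro allI impI)
        fix D a b assume ab: "a \<noteq> (0::int)" "b \<noteq> (0::int)" and D: "D dvd smult a M" "D dvd smult b r"
        obtain E where E: "smult a M = D * E" using D(1) by (auto elim: dvdE)
        obtain E' where E': "smult b r = D * E'" using D(2) by (auto elim: dvdE)
        have "D * E \<noteq> 0" using E[symmetric] ab M by simp
        then have nz: "D \<noteq> 0" "E \<noteq> 0" by auto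
        have "poly (cpoly D) \<alpha> \<noteq> 0"
          using arg_cong[OF E', of "\<lambda>A. poly (cpoly A) \<alpha>"] r(3) ab by (auto simp: cpoly_smult cpoly_mult)
        moreover have "poly (cpoly D) \<alpha> * poly (cpoly E) \<alpha> = 0"
          using arg_cong[OF E, of "\<lambda>A. poly (cpoly A) \<alpha>"] M(2) by (simp add: cpoly_smult cpoly_mult)
        ultimately have "degree M \<le> degree E" using nz by (intro minimal) auto
        moreover have "degree M = degree D + degree E"
          using arg_cong[OF E, of degree] nz ab by (simp add: degree_mult_eq)
        ultimately show "degree D = 0" by simp
      qed
      then have "1 \<le> C0 * (C * H * h) ^ K * max (norm (poly (cpoly M) \<alpha>)) (norm (poly (cpoly r) \<alpha>))"
        using r(1) M(1) bounds
        by (intro euclid height_le_mono[OF h(2)] height_le_mono[OF r(2)]) auto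
      also have "max (norm (poly (cpoly M) \<alpha>)) (norm (poly (cpoly r) \<alpha>)) = norm (poly (cpoly r) \<alpha>)"
        using M(2) by simp
      also have "C0 * (C * H * h) ^ K * norm (poly (cpoly r) \<alpha>)
          \<le> C0 * (C * H * h) ^ K * (C * norm (poly (cpoly Q) \<alpha>))"
        using r(4) C0 C Q(2) h by (intro mult_left_mono) auto
      finally show "1 \<le> C0 * (C * h) ^ K * C * H ^ K * norm (poly (cpoly Q) \<alpha>)"
        by (simp add: power_mult_distrib mult_ac)
    qed
  qed
qed

lemma algebraic_real_int_poly:
  fixes x :: real
  assumes "algebraic x"
  obtains M where "M \<noteq> 0" "poly (cpoly M) (of_real x) = 0"
proof -
  obtain q where q: "\<And>i. coeff q i \<in> \<int>" "q \<noteq> 0" "poly q x = 0"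
    using assms unfolding algebraic_def by blast
  define M where "M = map_poly floor q"
  have c: "of_int (coeff M i) = coeff q i" for i
    using q(1)[of i] by (auto simp: M_def coeff_map_poly elim: Ints_cases)
  have cM: "cpoly M = map_poly of_real q"
    by (intro poly_eqI) (simp add: coeff_map_poly flip: c)
  have "poly (cpoly M) (of_real x) = of_real (poly q x)"
    unfolding cM by (simp add: poly_altdef degree_map_poly coeff_map_poly)
  moreover have "M \<noteq> 0" using c q(2) by (metis coeff_0 of_int_0 poly_eqI)
  ultimately show thesis using that q(3) by simp
qed

section \<open>Mahler's method and Pade forms\<close>

context sign_mahler
begin

definition Fi :: "int fps" where "Fi = Abs_fps f"

lemma Fc_power_nth: "(Fc ^ j) $ i = of_int ((Fi ^ j) $ i)"
proof (induction j arbitrary: i)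
  case 0
  then show ?case by simp
next
  case (Suc j)
  then show ?case by (simp add: fps_mult_nth Fi_def)
qed

lemma relation_nth:
  "(\<Sum>j\<le>m. fps_of_poly (cpoly (A j)) * Fc ^ j) $ i
    = of_int (\<Sum>j\<le>m. \<Sum>l\<le>i. coeff (A j) l * (Fi ^ j) $ (i - l))"
  by (simp add: fps_sum_nth fps_mult_nth Fc_power_nth coeff_map_poly atLeast0AtMost)

text \<open>There are \<open>(N + 1) * (m + 1)\<close> unknown coefficients against \<open>n\<close>
  linear conditions. No bound on their size is kept, because the relation is fixed before
  \<open>k\<close> grows.\<close>

lemma auxiliary_relation:
  assumes n: "n < (N + 1) * (m + 1)"
  shows "\<exists>A :: nat \<Rightarrow> int poly. (\<forall>j. degree (A j) \<le> N) \<and> (\<exists>j\<le>m. A j \<noteq> 0) \<and>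
    (\<forall>i<n. (\<Sum>j\<le>m. fps_of_poly (cpoly (A j)) * Fc ^ j) $ i = 0)"
proof -
  define I where "I = {..m} \<times> {..N}"
  have "finite I" "n < card I" using n by (simp_all add: I_def mult.commute)
  from underdetermined_system[OF this, of "\<lambda>i (j, l). if l \<le> i then (Fi ^ j) $ (i - l) else 0"]
  obtain x where x: "\<exists>k\<in>I. x k \<noteq> (0::int)"
    "\<And>i. i < n \<Longrightarrow> (\<Sum>k\<in>I. (case k of (j, l) \<Rightarrow> if l \<le> i then (Fi ^ j) $ (i - l) else 0) * x k) = 0"
    by blast
  define A where "A = (\<lambda>j. \<Sum>l\<le>N. monom (x (j, l)) l)"
  have coeff_A: "coeff (A j) l = (if l \<le> N then x (j, l) else 0)" for j l
    by (simp add: A_def coeff_sum)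
  show ?thesis
  proof (intro exI[of _ A] conjI allI impI)
    show "degree (A j) \<le> N" for j
      by (rule degree_le) (simp add: coeff_A)
    obtain j l where "j \<le> m" "l \<le> N" "x (j, l) \<noteq> 0" using x(1) by (auto simp: I_def)
    then have "coeff (A j) l \<noteq> 0" by (simp add: coeff_A)
    then show "\<exists>j\<le>m. A j \<noteq> 0" using \<open>j \<le> m\<close> by (intro exI[of _ j]) auto
    fix i assume i: "i < n"
    have "(\<Sum>l\<le>i. coeff (A j) l * (Fi ^ j) $ (i - l))
        = (\<Sum>l\<le>N. (if l \<le> i then (Fi ^ j) $ (i - l) else 0) * x (j, l))" for j
    proof -
      have "(\<Sum>l\<le>i. coeff (A j) l * (Fi ^ j) $ (i - l))
          = (\<Sum>l\<in>{..i} \<inter> {..N}. x (j, l) * (Fi ^ j) $ (i - l))"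
        by (rule sum.mono_neutral_cong_right) (auto simp: coeff_A)
      also have "\<dots> = (\<Sum>l\<le>N. (if l \<le> i then (Fi ^ j) $ (i - l) else 0) * x (j, l))"
        by (rule sum.mono_neutral_cong_left) auto
      finally show ?thesis .
    qed
    then have "(\<Sum>j\<le>m. \<Sum>l\<le>i. coeff (A j) l * (Fi ^ j) $ (i - l)) = 0"
      using x(2)[OF i] by (simp add: I_def sum.cartesian_product case_prod_unfold)
    then show "(\<Sum>j\<le>m. fps_of_poly (cpoly (A j)) * Fc ^ j) $ i = 0"
      unfolding relation_nth by simp
  qed
qed

text \<open>For large \<open>k\<close>, the relation \<open>E\<close> of order \<open>s\<close>
  yields integer polynomials of height at most of order \<open>w ^ (2 * m)\<close> whose value at
  \<open>\<xi>\<close> has exact order \<open>w ^ (2 * m)\<close> divided by \<open>w ^ s\<close>.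
  The value is nonzero by the lower bound in \<open>specialization\<close>, and too small for the
  Liouville inequality.\<close>

lemma eval_Fc_transcendental:
  assumes b: "b \<ge> 2" and M: "M \<noteq> 0"
  shows "poly (cpoly M) (eval_fps Fc (1 / of_int b)) \<noteq> 0"
proof
  define \<xi> where "\<xi> = eval_fps Fc (1 / of_int b)"
  assume "poly (cpoly M) (eval_fps Fc (1 / of_int b)) = 0"
  then have "poly (cpoly M) \<xi> = 0" by (simp only: \<xi>_def)
  with M obtain K where liouville: "\<forall>n. \<exists>C>0. \<forall>Q H. degree Q \<le> n \<longrightarrow> H \<ge> 1 \<longrightarrow> height_le Q H \<longrightarrow>
    poly (cpoly Q) \<xi> \<noteq> 0 \<longrightarrow> 1 \<le> C * H ^ K * norm (poly (cpoly Q) \<xi>)"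
    by (rule liouville_lower_bound)
  \<comment> \<open>For this \<open>m\<close> the order \<open>m * (m + 2)\<close> exceeds by
    \<open>m\<close> the exponent \<open>m * (2 * K + 2)\<close> that the Liouville inequality
    tolerates.\<close>
  define m where "m = 2 * K + 1"
  from liouville[THEN spec, of m] obtain C1 where C1: "C1 > 0"
    and lower: "\<forall>Q H. degree Q \<le> m \<longrightarrow> H \<ge> 1 \<longrightarrow> height_le Q H \<longrightarrow>
      poly (cpoly Q) \<xi> \<noteq> 0 \<longrightarrow> 1 \<le> C1 * H ^ K * norm (poly (cpoly Q) \<xi>)"
    by (elim exE conjE)
  have "m * (m + 2) < (m + 1) * (m + 1)" by simp
  from auxiliary_relation[OF this] obtain A where aux:
    "(\<forall>j. degree (A j) \<le> m) \<and> (\<exists>j\<le>m. A j \<noteq> 0) \<and>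
      (\<forall>i<m * (m + 2). (\<Sum>j\<le>m. fps_of_poly (cpoly (A j)) * Fc ^ j) $ i = 0)" ..
  note deg_A = conjunct1[OF aux] and A = conjunct1[OF conjunct2[OF aux]] conjunct2[OF conjunct2[OF aux]]
  define E where "E = (\<Sum>j\<le>m. fps_of_poly (cpoly (A j)) * Fc ^ j)"
  have E0: "E \<noteq> 0"
  proof
    assume "E = 0"
    then have "cpoly (A j) = 0" if "j \<le> m" for j
      using Fc_transcendental[of "\<lambda>j. cpoly (A j)" m] that by (simp add: E_def)
    then have "A j = 0" if "j \<le> m" for j
      using that by (simp add: map_poly_eq_0_iff)
    then show False using A(1) by auto
  qed
  have s: "subdegree E \<ge> m * (m + 2)"
    using A(2) E0 by (intro subdegree_geI) (simp_all add: E_def)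
  from specialization[OF b deg_A[rule_format] E_def E0, folded \<xi>_def]
  obtain c C k0 where c: "c > 0" "C > 0" and forms: "\<forall>k\<ge>k0. \<exists>q::nat \<Rightarrow> int.
      (\<forall>j\<le>m. \<bar>real_of_int (q j)\<bar> \<le> C * of_int (b ^ (p ^ k)) ^ (m + m)) \<and>
      c * of_int (b ^ (p ^ k)) ^ (m + m)
        \<le> norm (\<Sum>j\<le>m. of_int (q j) * \<xi> ^ j) * of_int (b ^ (p ^ k)) ^ subdegree E \<and>
      norm (\<Sum>j\<le>m. of_int (q j) * \<xi> ^ j) * of_int (b ^ (p ^ k)) ^ subdegree E
        \<le> C * of_int (b ^ (p ^ k)) ^ (m + m)"
    by (elim exE conjE)
  define D where "D = C1 * (max 1 C) ^ K * C"
  obtain k where "max D (real k0) < real k" using reals_Archimedean2 by blast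
  then have k: "k \<ge> k0" "D < real k" by simp_all
  define w where "w = real_of_int (b ^ (p ^ k))"
  have "int k < b ^ (p ^ k)" by (rule less_base_power[OF b])
  then have wk: "w > real k" unfolding w_def by linarith
  have "b ^ (p ^ k) \<ge> 1" using b by simp
  then have w1: "w \<ge> 1" unfolding w_def by linarith
  from forms[rule_format, OF k(1), folded w_def] obtain q :: "nat \<Rightarrow> int" where
    q_all: "(\<forall>j\<le>m. \<bar>real_of_int (q j)\<bar> \<le> C * w ^ (m + m)) \<and>
    c * w ^ (m + m) \<le> norm (\<Sum>j\<le>m. of_int (q j) * \<xi> ^ j) * w ^ subdegree E \<and>
    norm (\<Sum>j\<le>m. of_int (q j) * \<xi> ^ j) * w ^ subdegree E \<le> C * w ^ (m + m)" ..
  note q = conjunct1[OF q_all, rule_format] conjunct1[OF conjunct2[OF q_all]]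
    conjunct2[OF conjunct2[OF q_all]]
  define Q where "Q = (\<Sum>j\<le>m. monom (q j) j)"
  have coeff_Q: "coeff Q j = (if j \<le> m then q j else 0)" for j
    by (simp add: Q_def coeff_sum)
  have degree_Q: "degree Q \<le> m" by (rule degree_le) (simp add: coeff_Q)
  have poly_Q: "poly (cpoly Q) \<xi> = (\<Sum>j\<le>m. of_int (q j) * \<xi> ^ j)"
    unfolding poly_altdef
    by (rule sum.mono_neutral_cong_left)
      (use degree_Q in \<open>auto simp: degree_map_poly coeff_map_poly coeff_Q intro!: le_degree\<close>)
  have "max 1 C * w ^ (m + m) \<ge> 1 * 1" using w1 by (intro mult_mono one_le_power) auto
  then have H1: "max 1 C * w ^ (m + m) \<ge> 1" by simp
  have H: "height_le Q (max 1 C * w ^ (m + m))"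
    unfolding height_le_def
  proof
    fix i
    have "C * w ^ (m + m) \<le> max 1 C * w ^ (m + m)" using w1 by (intro mult_right_mono) auto
    then show "\<bar>real_of_int (coeff Q i)\<bar> \<le> max 1 C * w ^ (m + m)"
      using q(1)[of i] H1 by (auto simp: coeff_Q)
  qed
  have "c * w ^ (m + m) > 0" using c w1 by simp
  then have nz: "poly (cpoly Q) \<xi> \<noteq> 0" using q(2) unfolding poly_Q by auto
  have "w ^ (m * (m + 2)) \<le> w ^ subdegree E" using s w1 by (rule power_increasing)
  also have "\<dots> \<le> C1 * (max 1 C * w ^ (m + m)) ^ K * norm (poly (cpoly Q) \<xi>) * w ^ subdegree E"
    using mult_right_mono[OF lower[rule_format, OF degree_Q H1 H nz], of "w ^ subdegree E"] w1 by simp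
  also have "\<dots> = C1 * (max 1 C * w ^ (m + m)) ^ K * (norm (poly (cpoly Q) \<xi>) * w ^ subdegree E)"
    by simp
  also have "\<dots> \<le> C1 * (max 1 C * w ^ (m + m)) ^ K * (C * w ^ (m + m))"
    using q(3) C1 w1 unfolding poly_Q by (intro mult_left_mono) auto
  also have "\<dots> = D * w ^ (m * (2 * K + 2))"
  proof -
    have "m * (2 * K + 2) = (m + m) * K + (m + m)" by (simp add: algebra_simps)
    then have "w ^ (m * (2 * K + 2)) = (w ^ (m + m)) ^ K * w ^ (m + m)"
      by (simp only: power_add power_mult)
    then show ?thesis unfolding D_def power_mult_distrib by (simp only: mult_ac)
  qed
  finally have "w ^ (m * (m + 2)) \<le> D * w ^ (m * (2 * K + 2))" .
  moreover have "w ^ (m * (m + 2)) = w ^ m * w ^ (m * (2 * K + 2))"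
    by (simp add: m_def power_add[symmetric] algebra_simps)
  ultimately have "w ^ m \<le> D" using w1 by simp
  moreover have "w ^ 1 \<le> w ^ m" using w1 by (intro power_increasing) (auto simp: m_def)
  ultimately show False using wk k(2) by simp
qed

text \<open>\<open>Q\<close> has \<open>n + 1\<close> coefficients for the \<open>n\<close>
  conditions at degrees \<open>n\<close> to \<open>2 * n - 1\<close>; lower degrees are absorbed by
  \<open>R\<close>. If the coefficient at \<open>2 * n\<close> vanished too, the coefficients of
  \<open>Q\<close> in reverse order would form a kernel vector of a Hankel matrix.\<close>

lemma pade_relation:
  assumes n: "n \<ge> 1"
  obtains A :: "nat \<Rightarrow> int poly" where "\<And>j. degree (A j) \<le> n"
    "(\<Sum>j\<le>1. fps_of_poly (cpoly (A j)) * Fc ^ j) \<noteq> 0"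
    "subdegree (\<Sum>j\<le>1. fps_of_poly (cpoly (A j)) * Fc ^ j) = 2 * n"
proof -
  have "finite {..n}" "n < card {..n}" by auto
  from underdetermined_system[OF this, of "\<lambda>k i. f (n + k - i)"]
  obtain x where x: "\<exists>i\<le>n. x i \<noteq> (0::int)" "\<And>k. k < n \<Longrightarrow> (\<Sum>i\<le>n. f (n + k - i) * x i) = 0"
    by auto
  define Q where "Q = (\<Sum>i\<le>n. monom (x i) i)"
  define R where "R = - (\<Sum>k<n. monom ((fps_of_poly Q * Fi) $ k) k)"
  define A where "A = (\<lambda>j::nat. if j = 0 then R else Q)"
  define E where "E = (\<Sum>j\<le>1. fps_of_poly (cpoly (A j)) * Fc ^ j)"
  have coeff_Q: "coeff Q i = (if i \<le> n then x i else 0)" for i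
    by (simp add: Q_def coeff_sum)
  have coeff_R: "coeff R i = (if i < n then - (fps_of_poly Q * Fi) $ i else 0)" for i
    by (simp add: R_def coeff_sum)
  have E_nth: "E $ i = of_int (coeff R i + (fps_of_poly Q * Fi) $ i)" for i
    by (simp add: E_def A_def fps_mult_nth coeff_map_poly Fi_def)
  have QF: "(fps_of_poly Q * Fi) $ (n + k) = (\<Sum>i\<le>n. f (n + k - i) * x i)" for k
  proof -
    have "(fps_of_poly Q * Fi) $ (n + k) = (\<Sum>i\<le>n + k. coeff Q i * f (n + k - i))"
      by (simp add: fps_mult_nth Fi_def atLeast0AtMost)
    also have "\<dots> = (\<Sum>i\<le>n. f (n + k - i) * x i)"
      by (rule sum.mono_neutral_cong_right) (auto simp: coeff_Q)
    finally show ?thesis .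
  qed
  have zero: "E $ i = 0" if "i < 2 * n" for i
  proof (cases "i < n")
    case True
    then show ?thesis by (simp add: E_nth coeff_R)
  next
    case False
    then obtain k where k: "i = n + k" by (metis le_Suc_ex not_less)
    with that have "k < n" by simp
    then show ?thesis using x(2) by (simp add: k E_nth coeff_R QF)
  qed
  have nonzero: "E $ (2 * n) \<noteq> 0"
  proof
    assume "E $ (2 * n) = 0"
    then have "coeff R (2 * n) + (fps_of_poly Q * Fi) $ (2 * n) = 0"
      unfolding E_nth of_int_eq_0_iff .
    then have "(\<Sum>i\<le>n. f (n + n - i) * x i) = 0"
      using QF[of n] coeff_R[of "2 * n"] by (simp add: mult_2)
    then have eqs: "(\<Sum>i\<le>n. f (n + j - i) * x i) = 0" if "j \<le> n" for j
      using x(2)[of j] that by (cases "j = n") auto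
    have "x (n - i) = 0" if "i \<le> n" for i
    proof (rule hankel_nonsingular[of n "\<lambda>i. x (n - i)", OF _ that])
      fix j assume "j \<le> n"
      have "(\<Sum>i\<le>n. x (n - i) * f (i + j)) = (\<Sum>i\<le>n. x (n - (n - i)) * f (n - i + j))"
        using sum.nat_diff_reindex[of "\<lambda>i. x (n - i) * f (i + j)" "Suc n"]
        by (simp only: lessThan_Suc_atMost diff_Suc_Suc)
      also have "\<dots> = (\<Sum>i\<le>n. f (n + j - i) * x i)"
        by (intro sum.cong) (auto simp: mult.commute)
      finally show "(\<Sum>i\<le>n. x (n - i) * f (i + j)) = 0" using eqs[OF \<open>j \<le> n\<close>] by simp
    qed
    from this[of "n - _"] show False using x(1) by (metis diff_diff_cancel diff_le_self)
  qed
  have E0: "E \<noteq> 0" using nonzero by auto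
  show thesis
  proof (rule that[of A])
    show "degree (A j) \<le> n" for j
      unfolding A_def using coeff_Q coeff_R by (auto intro!: degree_le)
    show "(\<Sum>j\<le>1. fps_of_poly (cpoly (A j)) * Fc ^ j) \<noteq> 0"
      using E0 unfolding E_def .
    show "subdegree (\<Sum>j\<le>1. fps_of_poly (cpoly (A j)) * Fc ^ j) = 2 * n"
      unfolding E_def[symmetric] using nonzero zero by (intro subdegreeI) auto
  qed
qed

lemma eval_Fc_real:
  assumes b: "b \<ge> 2"
  shows "eval_fps Fc (1 / of_int b)
    = of_real (fps_eval_real (mahler_prod_fps p P) (1 / real_of_int b))"
proof -
  define x where "x = 1 / real_of_int b"
  have x: "0 < x" "x < 1" using b by (auto simp: x_def)
  have "summable (\<lambda>n. real_of_int (f n) * x ^ n)"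
  proof (rule summable_comparison_test')
    show "summable (\<lambda>n. x ^ n)" using x by (intro summable_geometric) simp
    show "norm (real_of_int (f n) * x ^ n) \<le> x ^ n" if "n \<ge> 0" for n
      using f_sign[of n] x by auto
  qed
  then have "(\<lambda>n. real_of_int (f n) * x ^ n) sums fps_eval_real (mahler_prod_fps p P) x"
    unfolding fps_eval_real_def f_def by (rule summable_sums)
  then have "(\<lambda>n. complex_of_real (real_of_int (f n) * x ^ n))
      sums of_real (fps_eval_real (mahler_prod_fps p P) x)"
    by (rule sums_of_real)
  then have "(\<lambda>n. Fc $ n * of_real x ^ n) sums of_real (fps_eval_real (mahler_prod_fps p P) x)"
    by simp
  then have "eval_fps Fc (of_real x) = of_real (fps_eval_real (mahler_prod_fps p P) x)"
    unfolding eval_fps_def by (rule sums_unique[symmetric])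
  then show ?thesis by (simp add: x_def)
qed

lemma not_algebraic_value:
  assumes "b \<ge> 2"
  shows "\<not> algebraic (fps_eval_real (mahler_prod_fps p P) (1 / real_of_int b))"
  using algebraic_real_int_poly eval_Fc_transcendental[OF assms] eval_Fc_real[OF assms] by metis

text \<open>The case \<open>m = 1\<close>, \<open>N = n\<close> of \<open>specialization\<close>.
  With \<open>W = b ^ (p ^ k)\<close> the coefficient \<open>q1\<close> has order at most
  \<open>W ^ (n + 1)\<close> and the form has exact order \<open>1 / W ^ (n - 1)\<close>; the ratio
  of these exponents tends to 1 as \<open>n\<close> grows.\<close>

lemma linear_forms:
  assumes b: "b \<ge> 2" and n: "n \<ge> 1"
  shows "\<exists>c C k0. c > 0 \<and> C > 0 \<and> (\<forall>k\<ge>k0. \<exists>(q0::int) (q1::int).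
    \<bar>real_of_int q1\<bar> \<le> C * of_int (b ^ (p ^ k)) ^ (n + 1) \<and>
    c * of_int (b ^ (p ^ k)) ^ (n + 1)
      \<le> \<bar>q0 + q1 * fps_eval_real (mahler_prod_fps p P) (1 / real_of_int b)\<bar> * of_int (b ^ (p ^ k)) ^ (2 * n) \<and>
    \<bar>q0 + q1 * fps_eval_real (mahler_prod_fps p P) (1 / real_of_int b)\<bar> * of_int (b ^ (p ^ k)) ^ (2 * n)
      \<le> C * of_int (b ^ (p ^ k)) ^ (n + 1))"
proof -
  define \<xi> where "\<xi> = fps_eval_real (mahler_prod_fps p P) (1 / real_of_int b)"
  obtain A where A: "\<And>j. degree (A j) \<le> n"
    "(\<Sum>j\<le>1. fps_of_poly (cpoly (A j)) * Fc ^ j) \<noteq> 0"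
    "subdegree (\<Sum>j\<le>1. fps_of_poly (cpoly (A j)) * Fc ^ j) = 2 * n"
    using pade_relation[OF n] by blast
  note forms = specialization[OF b A(1) refl A(2), unfolded A(3) eval_Fc_real[OF b], folded \<xi>_def]
  have nrm: "norm (\<Sum>j\<le>1. of_int (q j) * complex_of_real \<xi> ^ j) = \<bar>q 0 + q 1 * \<xi>\<bar>" for q :: "nat \<Rightarrow> int"
  proof -
    have "(\<Sum>j\<le>1. of_int (q j) * complex_of_real \<xi> ^ j) = of_real (q 0 + q 1 * \<xi>)" by simp
    then show ?thesis by (simp only: norm_of_real)
  qed
  from forms obtain c C k0 where c: "c > 0" "C > 0" and forms': "\<forall>k\<ge>k0. \<exists>q::nat \<Rightarrow> int.
      (\<forall>j\<le>1. \<bar>real_of_int (q j)\<bar> \<le> C * of_int (b ^ (p ^ k)) ^ (n + 1)) \<and>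
      c * of_int (b ^ (p ^ k)) ^ (n + 1) \<le> \<bar>q 0 + q 1 * \<xi>\<bar> * of_int (b ^ (p ^ k)) ^ (2 * n) \<and>
      \<bar>q 0 + q 1 * \<xi>\<bar> * of_int (b ^ (p ^ k)) ^ (2 * n) \<le> C * of_int (b ^ (p ^ k)) ^ (n + 1)"
    unfolding nrm by (elim exE conjE)
  show ?thesis
    unfolding \<xi>_def[symmetric]
  proof (rule exI[of _ c], rule exI[of _ C], rule exI[of _ k0], intro conjI c allI impI)
    fix k assume "k \<ge> k0"
    with forms' show "\<exists>(q0::int) (q1::int). \<bar>real_of_int q1\<bar> \<le> C * of_int (b ^ (p ^ k)) ^ (n + 1) \<and>
      c * of_int (b ^ (p ^ k)) ^ (n + 1) \<le> \<bar>q0 + q1 * \<xi>\<bar> * of_int (b ^ (p ^ k)) ^ (2 * n) \<and>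
      \<bar>q0 + q1 * \<xi>\<bar> * of_int (b ^ (p ^ k)) ^ (2 * n) \<le> C * of_int (b ^ (p ^ k)) ^ (n + 1)"
      by (meson le_refl)
  qed
qed

end

section \<open>Irrationality exponent\<close>

text \<open>For each \<open>v\<close> there are \<open>n \<le> p N + 1\<close> and \<open>k\<close> such that the form of index \<open>(n, k)\<close> is just below \<open>1 / (2 v)\<close>:
  the exponents \<open>(n - 1) p\<^sup>k\<close> with \<open>N < n - 1 \<le> p N\<close> leave only gaps of relative size \<open>1 / N\<close>.\<close>

lemma rational_approximation_bound:
  fixes \<xi> :: real and b :: int and p N :: nat
  assumes b: "b \<ge> 2" and p: "p \<ge> 2" and N: "N \<ge> 1"
    and forms: "\<And>n. n \<ge> 1 \<Longrightarrow> \<exists>c C k0. c > 0 \<and> C > 0 \<and> (\<forall>k\<ge>k0. \<exists>(q0::int) (q1::int).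
      \<bar>real_of_int q1\<bar> \<le> C * of_int (b ^ (p ^ k)) ^ (n + 1) \<and>
      c * of_int (b ^ (p ^ k)) ^ (n + 1) \<le> \<bar>q0 + q1 * \<xi>\<bar> * of_int (b ^ (p ^ k)) ^ (2 * n) \<and>
      \<bar>q0 + q1 * \<xi>\<bar> * of_int (b ^ (p ^ k)) ^ (2 * n) \<le> C * of_int (b ^ (p ^ k)) ^ (n + 1))"
  shows "\<exists>c>0. \<exists>v0. \<forall>u v::int. v \<ge> v0 \<longrightarrow> v > 0 \<longrightarrow>
    c * real_of_int v powr (- (2 + 4 / real N)) \<le> \<bar>\<xi> - of_int u / of_int v\<bar>"
proof -
  define \<beta> where "\<beta> = real_of_int b"
  have \<beta>: "\<beta> \<ge> 2" using b by (simp add: \<beta>_def)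
  obtain cc CC kk where forms': "\<And>n. n \<ge> 1 \<Longrightarrow> cc n > 0 \<and> CC n > 0 \<and> (\<forall>k\<ge>kk n. \<exists>(q0::int) (q1::int).
      \<bar>real_of_int q1\<bar> \<le> CC n * of_int (b ^ (p ^ k)) ^ (n + 1) \<and>
      cc n * of_int (b ^ (p ^ k)) ^ (n + 1) \<le> \<bar>q0 + q1 * \<xi>\<bar> * of_int (b ^ (p ^ k)) ^ (2 * n) \<and>
      \<bar>q0 + q1 * \<xi>\<bar> * of_int (b ^ (p ^ k)) ^ (2 * n) \<le> CC n * of_int (b ^ (p ^ k)) ^ (n + 1))"
    using forms by metis
  \<comment> \<open>All indices used lie in this finite range, so one set of constants serves every
    \<open>v\<close>.\<close>
  define S where "S = {1..p * N + 1}"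
  define c where "c = Min (insert 1 (cc ` S))"
  define C where "C = 1 + (\<Sum>n\<in>S. CC n)"
  define k0 where "k0 = (\<Sum>n\<in>S. kk n)"
  have c: "0 < c" "c \<le> 1" using forms' by (auto simp: c_def S_def)
  have cS: "c \<le> cc n" if "n \<in> S" for n
    unfolding c_def by (rule Min_le) (use that in \<open>auto simp: S_def\<close>)
  have CS: "CC n \<le> C" if "n \<in> S" for n
  proof -
    have "CC n \<le> (\<Sum>n\<in>S. CC n)"
      using that forms' by (intro member_le_sum) (auto simp: S_def intro: less_imp_le)
    then show ?thesis by (simp add: C_def)
  qed
  have "(\<Sum>n\<in>S. CC n) \<ge> 0" using forms' by (intro sum_nonneg) (auto simp: S_def intro: less_imp_le)
  then have C: "C \<ge> 1" by (simp add: C_def)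
  have uniform: "\<exists>(q0::int) (q1::int). \<bar>real_of_int q1\<bar> \<le> C * (\<beta> ^ (p ^ k)) ^ (n + 1) \<and>
      c * (\<beta> ^ (p ^ k)) ^ (n + 1) \<le> \<bar>q0 + q1 * \<xi>\<bar> * (\<beta> ^ (p ^ k)) ^ (2 * n) \<and>
      \<bar>q0 + q1 * \<xi>\<bar> * (\<beta> ^ (p ^ k)) ^ (2 * n) \<le> C * (\<beta> ^ (p ^ k)) ^ (n + 1)"
    if n: "n \<in> S" and k: "k \<ge> k0" for n k
  proof -
    have "kk n \<le> k0" unfolding k0_def using n by (intro member_le_sum) (auto simp: S_def)
    then have "k \<ge> kk n" using k by simp
    moreover have "n \<ge> 1" using n by (simp add: S_def)
    ultimately have "\<exists>(q0::int) (q1::int). \<bar>real_of_int q1\<bar> \<le> CC n * (\<beta> ^ (p ^ k)) ^ (n + 1) \<and>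
      cc n * (\<beta> ^ (p ^ k)) ^ (n + 1) \<le> \<bar>q0 + q1 * \<xi>\<bar> * (\<beta> ^ (p ^ k)) ^ (2 * n) \<and>
      \<bar>q0 + q1 * \<xi>\<bar> * (\<beta> ^ (p ^ k)) ^ (2 * n) \<le> CC n * (\<beta> ^ (p ^ k)) ^ (n + 1)"
      using forms'[THEN conjunct2, THEN conjunct2, rule_format, of n k, unfolded of_int_power, folded \<beta>_def]
      by simp
    then obtain q0 q1 :: int where
      q: "\<bar>real_of_int q1\<bar> \<le> CC n * (\<beta> ^ (p ^ k)) ^ (n + 1) \<and>
      cc n * (\<beta> ^ (p ^ k)) ^ (n + 1) \<le> \<bar>q0 + q1 * \<xi>\<bar> * (\<beta> ^ (p ^ k)) ^ (2 * n) \<and>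
      \<bar>q0 + q1 * \<xi>\<bar> * (\<beta> ^ (p ^ k)) ^ (2 * n) \<le> CC n * (\<beta> ^ (p ^ k)) ^ (n + 1)"
      by (elim exE)
    have "(\<beta> ^ (p ^ k)) ^ (n + 1) \<ge> 0" using \<beta> by simp
    then have "c * (\<beta> ^ (p ^ k)) ^ (n + 1) \<le> cc n * (\<beta> ^ (p ^ k)) ^ (n + 1)"
      "CC n * (\<beta> ^ (p ^ k)) ^ (n + 1) \<le> C * (\<beta> ^ (p ^ k)) ^ (n + 1)"
      using cS[OF n] CS[OF n] by (auto intro: mult_right_mono)
    with q show ?thesis by (intro exI[of _ q0] exI[of _ q1]) linarith
  qed
  define e where "e = 2 + 4 / real N"
  define \<kappa> where "\<kappa> = c / C * (2 * C * \<beta>) powr (- e)"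
  have \<kappa>: "\<kappa> > 0" using c C \<beta> by (simp add: \<kappa>_def)
  have main: "\<kappa> * real_of_int v powr (- e) \<le> \<bar>\<xi> - of_int u / of_int v\<bar>"
    if v: "v \<ge> b ^ (N * p ^ k0)" "v > 0" for u v :: int
  proof -
    define V where "V = real_of_int v"
    have V: "V > 0" "V \<ge> \<beta> ^ (N * p ^ k0)"
      using v by (simp_all add: V_def \<beta>_def flip: of_int_power)
    have CV: "2 * C * V > V"
    proof -
      have "1 * V < (2 * C) * V" using C V by (intro mult_strict_right_mono) auto
      then show ?thesis by simp
    qed
    obtain t0 where "2 * C * V < \<beta> ^ t0" using real_arch_pow[of \<beta>] \<beta> by auto
    then have ex: "\<exists>t. 2 * C * V \<le> \<beta> ^ t" by (auto intro: less_imp_le)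
    \<comment> \<open>The form should be at most \<open>1 / (2 * V)\<close>. As
      \<open>L * w' \<le> C\<close>, any \<open>w' \<ge> \<beta> ^ t\<close> achieves this, and
      minimality keeps \<open>\<beta> ^ t\<close> within a constant factor of
      \<open>V\<close>.\<close>
    define t where "t = (LEAST t. 2 * C * V \<le> \<beta> ^ t)"
    have t: "2 * C * V \<le> \<beta> ^ t" unfolding t_def using ex by (rule LeastI_ex)
    have "\<beta> ^ (N * p ^ k0) < \<beta> ^ t" using t CV V by linarith
    then have tN: "N * p ^ k0 < t" using \<beta> by (simp add: power_strict_increasing_iff)
    then obtain t' where t': "t = Suc t'" by (cases t) auto
    have "\<not> 2 * C * V \<le> \<beta> ^ t'" using not_less_Least[of t' "\<lambda>t. 2 * C * V \<le> \<beta> ^ t"] t' by (simp add: t_def)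
    then have t_upper: "\<beta> ^ t \<le> 2 * C * \<beta> * V" using \<beta> by (simp add: t' mult_ac)
    have "t < p ^ t" using p by (intro power_gt_expt) simp
    also have "\<dots> \<le> N * p ^ t" using N by simp
    finally have exj: "\<exists>j. t < N * p ^ j" by blast
    \<comment> \<open>For \<open>j = Suc k\<close> this gives
      \<open>N * p ^ k \<le> t < N * p ^ Suc k\<close>: the upper bound keeps \<open>n\<close> in
      \<open>S\<close>, the lower one makes \<open>p ^ k\<close> at most
      \<open>t / N\<close>.\<close>
    define j where "j = (LEAST j. t < N * p ^ j)"
    have j: "t < N * p ^ j" unfolding j_def using exj by (rule LeastI_ex)
    have "k0 < j"
    proof (rule ccontr)
      assume "\<not> k0 < j"
      then have "p ^ j \<le> p ^ k0" using p by (intro power_increasing) auto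
      then have "N * p ^ j \<le> N * p ^ k0" by (rule mult_le_mono2)
      then show False using j tN by linarith
    qed
    then obtain k where k: "j = Suc k" "k \<ge> k0" by (cases j) auto
    have "\<not> t < N * p ^ k" using not_less_Least[of k "\<lambda>j. t < N * p ^ j"] k by (simp add: j_def)
    then have NP: "N * p ^ k \<le> t" by simp
    define P where "P = p ^ k"
    have P: "P > 0" using p by (simp add: P_def)
    \<comment> \<open>\<open>n - 1\<close> is the first integer above \<open>t / P\<close>, so
      \<open>P * (n - 1)\<close> exceeds \<open>t\<close> by at most \<open>P\<close> and
      \<open>P * (n + 1)\<close> by at most \<open>3 * P\<close>. Together these are the
      \<open>4 * P\<close> behind the term \<open>4 / N\<close> of \<open>e\<close>.\<close>
    define n where "n = t div P + 2"
    have "t div P < N * p"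
      using j k by (intro less_mult_imp_div_less) (simp add: P_def mult_ac)
    then have nS: "n \<in> S" by (simp add: n_def S_def mult.commute)
    have tP: "t = P * (t div P) + t mod P" "t mod P < P" using P by simp_all
    have n1: "P * (n - 1) = P * (t div P) + P" "P * (n + 1) = P * (t div P) + 3 * P"
      by (simp_all add: n_def algebra_simps)
    have exps: "t \<le> P * (n - 1)" "P * (n - 1) \<le> t + P" "P * (n + 1) \<le> t + 3 * P"
      using tP n1 by linarith+
    from uniform[OF nS k(2), folded P_def] obtain q0 q1 :: int where
      q_all: "\<bar>real_of_int q1\<bar> \<le> C * (\<beta> ^ P) ^ (n + 1) \<and>
      c * (\<beta> ^ P) ^ (n + 1) \<le> \<bar>q0 + q1 * \<xi>\<bar> * (\<beta> ^ P) ^ (2 * n) \<and>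
      \<bar>q0 + q1 * \<xi>\<bar> * (\<beta> ^ P) ^ (2 * n) \<le> C * (\<beta> ^ P) ^ (n + 1)"
      by (elim exE)
    note q = conjunct1[OF q_all] conjunct1[OF conjunct2[OF q_all]] conjunct2[OF conjunct2[OF q_all]]
    define L where "L = \<bar>q0 + q1 * \<xi>\<bar>"
    define w where "w = \<beta> ^ (P * (n + 1))"
    define w' where "w' = \<beta> ^ (P * (n - 1))"
    have w: "w > 0" using \<beta> by (simp add: w_def)
    have w_eq: "(\<beta> ^ P) ^ (n + 1) = w" by (simp only: w_def power_mult)
    have "P * (2 * n) = P * (n + 1) + P * (n - 1)" by (simp add: n_def algebra_simps)
    then have ww': "(\<beta> ^ P) ^ (2 * n) = w * w'"
      unfolding w_def w'_def by (simp only: power_mult[symmetric] power_add[symmetric])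
    have "w * c \<le> w * (L * w')" "w * (L * w') \<le> w * C"
      using q(2,3)[unfolded ww' w_eq, folded L_def] by (simp_all add: mult_ac)
    then have L: "c \<le> L * w'" "L * w' \<le> C" using w by simp_all
    have L0: "L \<ge> 0" by (simp add: L_def)
    have w'_lower: "2 * C * V \<le> w'"
      unfolding w'_def using t exps(1) \<beta> by (intro order.trans[OF t] power_increasing) auto
    have w'_upper: "w' \<le> \<beta> ^ (t + P)"
      unfolding w'_def using exps(2) \<beta> by (intro power_increasing) auto
    have w_upper: "w \<le> \<beta> ^ (t + 3 * P)"
      unfolding w_def using exps(3) \<beta> by (intro power_increasing) auto
    have "L * (2 * C * V) \<le> L * w'" using w'_lower L0 by (rule mult_left_mono)
    then have "C * (2 * (L * V)) \<le> C * 1" using L(2) by (simp add: mult_ac)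
    then have LV: "L * V \<le> 1 / 2" using C by simp
    define \<delta> where "\<delta> = \<bar>\<xi> - of_int u / of_int v\<bar>"
    have \<delta>V: "\<delta> * V = \<bar>V * \<xi> - of_int u\<bar>"
    proof -
      have "\<delta> * V = \<bar>(\<xi> - of_int u / of_int v) * V\<bar>" using V by (simp add: \<delta>_def abs_mult)
      also have "(\<xi> - of_int u / of_int v) * V = V * \<xi> - of_int u"
        using V by (simp add: V_def field_simps)
      finally show ?thesis .
    qed
    have id: "of_int (q1 * u + q0 * v) = V * (q0 + q1 * \<xi>) - q1 * (V * \<xi> - of_int u)"
      by (simp add: V_def algebra_simps)
    \<comment> \<open>If the integer \<open>q1 * u + q0 * v\<close> is nonzero, the form accounts
      for at most half of its absolute value, and the error \<open>\<delta>\<close> for the rest. If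
      it is zero, then \<open>L = \<bar>q1\<bar> * \<delta>\<close>, and the lower bound for the
      form decides.\<close>
    have key: "c \<le> \<bar>real_of_int q1\<bar> * \<delta> * \<beta> ^ (t + P)"
    proof (cases "q1 * u + q0 * v = 0")
      case True
      then have "V * (q0 + q1 * \<xi>) = q1 * (V * \<xi> - of_int u)" using id by simp
      then have "V * L = \<bar>real_of_int q1\<bar> * (\<delta> * V)"
        unfolding \<delta>V L_def using V by (metis abs_mult abs_of_pos)
      then have "L = \<bar>real_of_int q1\<bar> * \<delta>" using V by simp
      moreover have "L * w' \<le> L * \<beta> ^ (t + P)" using w'_upper L0 by (rule mult_left_mono)
      ultimately show ?thesis using L(1) by simp
    next
      case False
      then have "1 \<le> \<bar>q1 * u + q0 * v\<bar>" by simp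
      then have "1 \<le> \<bar>real_of_int (q1 * u + q0 * v)\<bar>" by linarith
      also have "\<dots> \<le> \<bar>V * (q0 + q1 * \<xi>)\<bar> + \<bar>q1 * (V * \<xi> - of_int u)\<bar>"
        unfolding id by (rule abs_triangle_ineq4)
      also have "\<bar>V * (q0 + q1 * \<xi>)\<bar> = L * V" using V by (simp add: abs_mult L_def)
      also have "\<bar>q1 * (V * \<xi> - of_int u)\<bar> = \<bar>real_of_int q1\<bar> * (\<delta> * V)"
        by (simp add: abs_mult \<delta>V)
      finally have "1 \<le> (\<bar>real_of_int q1\<bar> * \<delta>) * (2 * V)" using LV by (simp add: mult_ac)
      also have "\<dots> \<le> (\<bar>real_of_int q1\<bar> * \<delta>) * \<beta> ^ (t + P)"
      proof (rule mult_left_mono)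
        have "1 * (2 * V) \<le> C * (2 * V)" using C V by (intro mult_right_mono) auto
        also have "\<dots> \<le> \<beta> ^ (t + P)" using w'_lower w'_upper by (simp add: mult_ac)
        finally show "2 * V \<le> \<beta> ^ (t + P)" by simp
      qed (simp add: \<delta>_def)
      finally show ?thesis using c by simp
    qed
    have "c \<le> C * \<beta> ^ (t + 3 * P) * \<delta> * \<beta> ^ (t + P)"
    proof -
      have "\<bar>real_of_int q1\<bar> \<le> C * w" using q(1) by (simp only: w_eq)
      also have "\<dots> \<le> C * \<beta> ^ (t + 3 * P)" using w_upper C by (intro mult_left_mono) auto
      finally have "\<bar>real_of_int q1\<bar> * (\<delta> * \<beta> ^ (t + P)) \<le> C * \<beta> ^ (t + 3 * P) * (\<delta> * \<beta> ^ (t + P))"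
        using \<beta> by (intro mult_right_mono) (auto simp: \<delta>_def)
      then show ?thesis using key by (simp add: mult_ac)
    qed
    also have "\<dots> = C * \<delta> * \<beta> ^ (2 * t + 4 * P)"
    proof -
      have "2 * t + 4 * P = (t + 3 * P) + (t + P)" by simp
      then show ?thesis by (simp only: power_add mult_ac)
    qed
    also have "\<beta> ^ (2 * t + 4 * P) \<le> (2 * C * \<beta> * V) powr e"
    proof -
      have "real (N * P) \<le> real t" using NP unfolding P_def of_nat_le_iff .
      then have "4 * real P \<le> real t * (4 / real N)" using N by (simp add: field_simps)
      then have "real (2 * t + 4 * P) \<le> real t * e" by (simp add: e_def algebra_simps)
      then have "\<beta> powr real (2 * t + 4 * P) \<le> \<beta> powr (real t * e)"
        using \<beta> by (intro powr_mono) auto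
      also have "\<dots> = (\<beta> ^ t) powr e" using \<beta> by (simp add: powr_powr[symmetric] powr_realpow)
      also have "\<dots> \<le> (2 * C * \<beta> * V) powr e"
        using t_upper \<beta> by (intro powr_mono2) (auto simp: e_def)
      finally show ?thesis using \<beta> by (simp only: powr_realpow)
    qed
    finally have "c \<le> C * \<delta> * (2 * C * \<beta> * V) powr e"
      using C by (simp add: \<delta>_def mult_left_mono)
    also have "(2 * C * \<beta> * V) powr e = (2 * C * \<beta>) powr e * V powr e"
      using C \<beta> V by (simp add: powr_mult)
    finally have "\<kappa> * V powr (- e) \<le> \<delta>"
      using C \<beta> V by (simp add: \<kappa>_def powr_minus field_simps)
    then show ?thesis by (simp only: V_def \<delta>_def)
  qed
  show ?thesis
    using \<kappa> main unfolding e_def[symmetric]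
    by (intro exI[of _ \<kappa>] conjI exI[of _ "b ^ (N * p ^ k0)"] allI impI) auto
qed

section \<open>From approximation bounds to the exponent\<close>

lemma finite_good_approximations:
  fixes \<xi> \<mu> \<nu> c :: real
  assumes c: "c > 0" and \<mu>: "\<mu> > \<nu>" "\<nu> \<ge> 0"
    and lower: "\<And>u v::int. v \<ge> v0 \<Longrightarrow> v > 0 \<Longrightarrow> c * real_of_int v powr (- \<nu>) \<le> \<bar>\<xi> - of_int u / of_int v\<bar>"
  shows "finite {r::rat. \<bar>\<xi> - real_of_rat r\<bar> < real_of_int (snd (quotient_of r)) powr (- \<mu>)}"
    (is "finite ?X")
proof -
  \<comment> \<open>The two inequalities force \<open>v powr (\<mu> - \<nu>) \<le> 1 / c\<close>;
    denominators below \<open>v0\<close> are covered by the maximum. \<open>H\<close> then bounds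
    the numerators, since the error is at most 1.\<close>
  define B where "B = max (real_of_int v0) ((1 / c) powr (1 / (\<mu> - \<nu>)))"
  define H where "H = (\<bar>\<xi>\<bar> + 1) * B"
  have "quotient_of r \<in> {- \<lceil>H\<rceil>..\<lceil>H\<rceil>} \<times> {0..\<lceil>B\<rceil>}" if r: "r \<in> ?X" for r
  proof -
    obtain u v where uv: "quotient_of r = (u, v)" by (cases "quotient_of r")
    have v: "v > 0" using uv by (rule quotient_of_denom_pos)
    have "real_of_rat r = of_int u / of_int v"
      using quotient_of_div[OF uv] by (simp add: of_rat_divide)
    then have less: "\<bar>\<xi> - of_int u / of_int v\<bar> < real_of_int v powr (- \<mu>)" using r uv by simp
    have v1: "real_of_int v \<ge> 1" using v by simp
    have vB: "real_of_int v \<le> B"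
    proof (cases "v \<ge> v0")
      case True
      have "c * real_of_int v powr (- \<nu>) < real_of_int v powr (- \<mu>)"
        using lower[OF True v, of u] less by linarith
      then have "c * real_of_int v powr (- \<nu>) * real_of_int v powr \<mu>
          \<le> real_of_int v powr (- \<mu>) * real_of_int v powr \<mu>"
        by (intro mult_right_mono) auto
      then have "c * real_of_int v powr (\<mu> - \<nu>) \<le> 1"
        using v by (simp add: mult.assoc flip: powr_add)
      then have "real_of_int v powr (\<mu> - \<nu>) \<le> 1 / c" using c by (simp add: field_simps)
      then have "(real_of_int v powr (\<mu> - \<nu>)) powr (1 / (\<mu> - \<nu>)) \<le> (1 / c) powr (1 / (\<mu> - \<nu>))"
        using \<mu> by (intro powr_mono2) auto
      then show ?thesis using \<mu> v by (simp add: powr_powr B_def)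
    qed (simp add: B_def)
    have "real_of_int v powr (- \<mu>) \<le> real_of_int v powr 0" using \<mu> v1 by (intro powr_mono) auto
    then have "\<bar>of_int u / of_int v\<bar> \<le> \<bar>\<xi>\<bar> + 1" using less v by simp
    then have "\<bar>real_of_int u\<bar> \<le> (\<bar>\<xi>\<bar> + 1) * real_of_int v" using v by (simp add: abs_divide field_simps)
    also have "\<dots> \<le> H" unfolding H_def using vB by (intro mult_left_mono) auto
    finally have "\<bar>real_of_int u\<bar> \<le> H" .
    then have "- \<lceil>H\<rceil> \<le> u" "u \<le> \<lceil>H\<rceil>" by linarith+
    moreover have "v \<le> \<lceil>B\<rceil>" using vB by linarith
    ultimately show ?thesis using v by (simp add: uv)
  qed
  then have "quotient_of ` ?X \<subseteq> {- \<lceil>H\<rceil>..\<lceil>H\<rceil>} \<times> {0..\<lceil>B\<rceil>}" by blast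
  then have "finite (quotient_of ` ?X)" by (rule finite_subset) simp
  then show ?thesis by (rule finite_imageD) (auto simp: inj_on_def quotient_of_inject_eq)
qed

text \<open>Dirichlet's theorem for coprime pairs; coprimality makes each pair the
  \<open>quotient_of\<close> of its fraction, so no rational is counted twice.\<close>

lemma infinite_quadratic_approximations:
  fixes \<xi> :: real
  assumes "\<xi> \<notin> \<rat>"
  shows "infinite {r::rat. \<bar>\<xi> - real_of_rat r\<bar> < real_of_int (snd (quotient_of r)) powr (- 2)}"
    (is "infinite ?X")
proof
  assume fin: "finite ?X"
  have "approx_set \<xi> \<subseteq> quotient_of ` ?X"
  proof
    fix hk assume "hk \<in> approx_set \<xi>"
    then obtain h k where hk: "hk = (h, k)" "k > 0" "coprime h k" "\<bar>\<xi> - of_int h / of_int k\<bar> < 1 / k\<^sup>2"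
      by (auto simp: approx_set_def)
    have q: "quotient_of (Rat.Fract h k) = (h, k)" using hk by (simp add: quotient_of_Fract normalize_stable)
    have "real_of_rat (Rat.Fract h k) = of_int h / of_int k" using hk by (simp add: of_rat_rat)
    moreover have "real_of_int k powr (- 2) = 1 / k\<^sup>2" using hk by (simp add: powr_minus_divide powr_numeral)
    ultimately have "Rat.Fract h k \<in> ?X" using hk by (simp add: q)
    then show "hk \<in> quotient_of ` ?X" using q hk(1) by (metis imageI)
  qed
  then have "finite (approx_set \<xi>)" using fin by (meson finite_imageI finite_subset)
  then show False using assms rational_iff_finite_approx_set by blast
qed

lemma irrationality_exponent_eq_2:
  assumes irr: "\<xi> \<notin> \<rat>"
    and lower: "\<And>N::nat. N \<ge> 1 \<Longrightarrow> \<exists>c>0. \<exists>v0. \<forall>u v::int. v \<ge> v0 \<longrightarrow> v > 0 \<longrightarrow>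
      c * real_of_int v powr (- (2 + 4 / real N)) \<le> \<bar>\<xi> - of_int u / of_int v\<bar>"
  shows "irrationality_exponent \<xi> = 2"
  unfolding irrationality_exponent_def
proof (rule antisym)
  show "Sup (ereal ` {\<mu>. infinite {r. \<bar>\<xi> - real_of_rat r\<bar> < real_of_int (snd (quotient_of r)) powr - \<mu>}}) \<le> 2"
  proof (rule Sup_least, clarify)
    fix \<mu> assume inf: "infinite {r. \<bar>\<xi> - real_of_rat r\<bar> < real_of_int (snd (quotient_of r)) powr - \<mu>}"
    have "\<mu> \<le> 2"
    proof (rule ccontr)
      assume "\<not> \<mu> \<le> 2"
      then have "\<mu> - 2 > 0" by simp
      then obtain N :: nat where "4 / (\<mu> - 2) < real N" using reals_Archimedean2 by blast
      moreover have "4 / (\<mu> - 2) > 0" using \<open>\<mu> - 2 > 0\<close> by simp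
      ultimately have N: "N \<ge> 1" "4 / real N < \<mu> - 2"
        using \<open>\<mu> - 2 > 0\<close> by (cases N; auto simp: field_simps)+
      then show False using lower[OF N(1)] inf finite_good_approximations[of _ "2 + 4 / real N" \<mu> _ \<xi>]
        by fastforce
    qed
    then show "ereal \<mu> \<le> 2" by simp
  qed
  have "(2::ereal) = ereal 2" by simp
  also have "\<dots> \<le> Sup (ereal ` {\<mu>. infinite {r. \<bar>\<xi> - real_of_rat r\<bar> < real_of_int (snd (quotient_of r)) powr - \<mu>}})"
    using infinite_quadratic_approximations[OF irr] by (intro Sup_upper imageI) simp
  finally show "2 \<le> Sup (ereal ` {\<mu>. infinite {r. \<bar>\<xi> - real_of_rat r\<bar> < real_of_int (snd (quotient_of r)) powr - \<mu>}})" .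
qed

section \<open>Both conclusions for a general \<open>P\<close>, and the five instances\<close>

context sign_mahler
begin

lemma transcendental_irrationality_exponent:
  fixes b :: int
  assumes b: "b \<ge> 2"
  shows "\<not> algebraic (fps_eval_real (mahler_prod_fps p P) (1 / real_of_int b)) \<and>
    irrationality_exponent (fps_eval_real (mahler_prod_fps p P) (1 / real_of_int b)) = 2"
proof
  show na: "\<not> algebraic (fps_eval_real (mahler_prod_fps p P) (1 / real_of_int b))"
    by (rule not_algebraic_value[OF b])
  show "irrationality_exponent (fps_eval_real (mahler_prod_fps p P) (1 / real_of_int b)) = 2"
  proof (rule irrationality_exponent_eq_2)
    show "fps_eval_real (mahler_prod_fps p P) (1 / real_of_int b) \<notin> \<rat>"
      using na rat_imp_algebraic by blast
    show "\<exists>c>0. \<exists>v0. \<forall>u v::int. v \<ge> v0 \<longrightarrow> v > 0 \<longrightarrow> c * real_of_int v powr (- (2 + 4 / real N))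
        \<le> \<bar>fps_eval_real (mahler_prod_fps p P) (1 / real_of_int b) - of_int u / of_int v\<bar>"
      if "N \<ge> 1" for N :: nat
      by (rule rational_approximation_bound[OF b _ that linear_forms[OF b]]) (use p_ge in auto)
  qed
qed

end

text \<open>The locale conditions become finite checks on a list, with the digit relation ranging
  over an explicit interval, so that simplification decides them for concrete coefficients.\<close>

lemma sign_mahler_PolyI:
  assumes "odd p" "p \<ge> 3" "length cs = p" "set cs \<subseteq> {1, -1}"
    "cs ! 0 = 1" "cs ! 1 = -1" "cs ! 2 = -1"
    "\<forall>r\<in>set [0..<p - 1]. cs ! ((2 * r + 1) mod p) * cs ! ((2 * r + 2) mod p) * cs ! r * cs ! (r + 1) = -1"
  shows "sign_mahler p (Poly cs)"
proof
  have nth: "coeff (Poly cs) i = cs ! i" if "i < p" for i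
    using that assms(3) by (simp add: nth_default_nth)
  have sign: "cs ! i = 1 \<or> cs ! i = -1" if "i < p" for i
    using that assms(3,4) nth_mem[of i cs] by blast
  show "odd p" "p \<ge> 3" by fact+
  show "coeff (Poly cs) 0 = 1" "coeff (Poly cs) 1 = -1" "coeff (Poly cs) 2 = -1"
    using assms nth[of 0] nth[of 1] nth[of 2] by simp_all
  show "coeff (Poly cs) i = 1 \<or> coeff (Poly cs) i = -1" if "i < p" for i
    using sign[OF that] unfolding nth[OF that] .
  show "degree (Poly cs) = p - 1"
  proof (rule antisym)
    show "degree (Poly cs) \<le> p - 1"
      using assms(2,3) by (intro degree_le) (auto simp: nth_default_beyond)
    have "coeff (Poly cs) (p - 1) \<noteq> 0" using sign[of "p - 1"] nth[of "p - 1"] assms(2) by auto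
    then show "p - 1 \<le> degree (Poly cs)" by (rule le_degree)
  qed
  show "coeff (Poly cs) ((2 * r + 1) mod p) * coeff (Poly cs) ((2 * r + 2) mod p) *
      coeff (Poly cs) r * coeff (Poly cs) (r + 1) = -1" if "r < p - 1" for r
  proof -
    have "(2 * r + 1) mod p < p" "(2 * r + 2) mod p < p" "r < p" "r + 1 < p"
      using that assms(2) by auto
    with assms(8) that show ?thesis by (simp only: nth) simp
  qed
qed

lemma sign_mahler_instances:
  "sign_mahler 5 P5" "sign_mahler 11 P11" "sign_mahler 13 P13" "sign_mahler 17 P17a" "sign_mahler 17 P17b"
  unfolding P5_def P11_def P13_def P17a_def P17b_def
  by (rule sign_mahler_PolyI; simp add: upt_rec)+

theorem theorem7p2:
  fixes b :: int
  assumes "b \<ge> 2"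
  shows "\<forall>F \<in> {F5, F11, F13, F17a, F17b}.
           \<not> algebraic (fps_eval_real F (1 / real_of_int b)) \<and>
           irrationality_exponent (fps_eval_real F (1 / real_of_int b)) = 2"
  using sign_mahler_instances[THEN sign_mahler.transcendental_irrationality_exponent, OF assms]
  by (simp add: F5_def F11_def F13_def F17a_def F17b_def)

end
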